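(* Let $\Phi:G\to\mathrm{Aut}(H)$ be an action of a Lie group $G$ on a Lie group $H$, and let $\mathcal B:H\to G$ be a relative Rota-Baxter operator on $G$ with respect to $(H;\Phi)$. Let $\mathfrak g$ be the Lie algebra of $G$. For $h\in H$ consider the diffeomorphism $\Theta(h):G\to G$ given by $$\Theta(h)g=\big(\mathcal B(\Phi(g)h^\dagger)\big)^{-1}\cdot_G g\cdot_G\mathcal B(h^\dagger),\quad g\in G,$$ which fixes $e_G$, and denote its tangent map at $e_G$ again by $\Theta(h)=\Theta(h)_{*e_G}:\mathfrak g\to\mathfrak g$. Then $\Theta:H\to GL(\mathfrak g)$ is an action (i.e. a linear representation, a Lie group homomorphism to $GL(\mathfrak g)$) of the descendent Lie group $(H,e_H,\star)$ on the vector space $\mathfrak g$.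
   Context: Lie groups are real and finite-dimensional; $(G,e_G,\cdot_G)$ and $(H,e_H,\cdot_H)$ are Lie groups. An action of $G$ on $H$ is a group homomorphism $\Phi:G\to\mathrm{Aut}(H)$ into the Lie group automorphisms of $H$ such that $(g,h)\mapsto\Phi(g)h$ is smooth. A relative Rota-Baxter operator on $G$ with respect to $(H;\Phi)$ is a smooth map $\mathcal B:H\to G$ with $\mathcal B(h_1)\cdot_G\mathcal B(h_2)=\mathcal B(h_1\cdot_H\Phi(\mathcal B(h_1))h_2)$ for all $h_1,h_2\in H$. Its descendent Lie group is the manifold $H$ with multiplication $h_1\star h_2=h_1\cdot_H\Phi(\mathcal B(h_1))h_2$, unit $e_H$, and inverse $h^\dagger=\Phi(\mathcal B(h)^{-1})h^{-1}$, where $h^{-1}$ is the inverse in $(H,\cdot_H)$. *)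

theory Defs
  imports
    "HOL-Analysis.Analysis"
    "HOL-Algebra.Bij"
    "HOL-Library.Function_Algebras"
begin

section \<open>Smooth maps between finite-dimensional normed spaces\<close>

definition finite_dim :: "'e::real_vector itself \<Rightarrow> bool" where
  "finite_dim _ \<longleftrightarrow> (\<exists>B::'e set. finite B \<and> span B = UNIV)"

text \<open>In finite dimension the condition below is that \<open>f\<close> is of class \<open>C\<^sup>n\<close> on the open set
  \<open>S\<close>: the derivative is \<open>C\<close> of one order less iff all \<open>x \<mapsto> D f(x) v\<close> are.\<close>

primrec Ck_on :: "nat \<Rightarrow> 'a::real_normed_vector set \<Rightarrow> ('a \<Rightarrow> 'b::real_normed_vector) \<Rightarrow> bool" where
  "Ck_on 0 S f \<longleftrightarrow> continuous_on S f"
| "Ck_on (Suc n) S f \<longleftrightarrow>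
     (\<forall>x\<in>S. f differentiable (at x)) \<and> (\<forall>v. Ck_on n S (\<lambda>x. frechet_derivative f (at x) v))"

definition smooth_on :: "'a::real_normed_vector set \<Rightarrow> ('a \<Rightarrow> 'b::real_normed_vector) \<Rightarrow> bool" where
  "smooth_on S f \<longleftrightarrow> (\<forall>n. Ck_on n S f)"


section \<open>Smooth manifolds\<close>

text \<open>A chart is a pair \<open>(U, \<phi>)\<close>; only the values of \<open>\<phi>\<close> on \<open>U\<close> matter.
  The model space is a type \<open>'e::real_normed_vector\<close> required to be finite-dimensional
  (rather than a type of class \<open>euclidean_space\<close>), so that dimension 0 is not excluded and
  \<open>'e \<Rightarrow>\<^sub>L 'e\<close> is again an admissible model space. Atlases need not be maximal.\<close>

type_synonym ('a, 'e) chart = "'a set \<times> ('a \<Rightarrow> 'e)"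

record ('a, 'e) manifold =
  mtop :: "'a topology"
  atlas :: "('a, 'e) chart set"

definition smooth_manifold :: "('a, 'e::real_normed_vector) manifold \<Rightarrow> bool" where
  "smooth_manifold M \<longleftrightarrow>
     finite_dim TYPE('e) \<and>
     Hausdorff_space (mtop M) \<and> second_countable (mtop M) \<and>
     (\<Union>(U, \<phi>)\<in>atlas M. U) = topspace (mtop M) \<and>
     (\<forall>(U, \<phi>)\<in>atlas M. openin (mtop M) U \<and> open (\<phi> ` U) \<and>
        homeomorphic_map (subtopology (mtop M) U) (top_of_set (\<phi> ` U)) \<phi>) \<and>
     (\<forall>(U, \<phi>)\<in>atlas M. \<forall>(V, \<psi>)\<in>atlas M. smooth_on (\<phi> ` (U \<inter> V)) (\<psi> \<circ> inv_into U \<phi>))"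

definition smooth_map ::
    "('a, 'e::real_normed_vector) manifold \<Rightarrow> ('b, 'f::real_normed_vector) manifold \<Rightarrow> ('a \<Rightarrow> 'b) \<Rightarrow> bool"
  where
  "smooth_map M N f \<longleftrightarrow>
     continuous_map (mtop M) (mtop N) f \<and>
     (\<forall>(U, \<phi>)\<in>atlas M. \<forall>(V, \<psi>)\<in>atlas N. smooth_on (\<phi> ` (U \<inter> f -` V)) (\<psi> \<circ> f \<circ> inv_into U \<phi>))"

definition diffeomorphism ::
    "('a, 'e::real_normed_vector) manifold \<Rightarrow> ('b, 'f::real_normed_vector) manifold \<Rightarrow> ('a \<Rightarrow> 'b) \<Rightarrow> bool"
  where
  "diffeomorphism M N f \<longleftrightarrow>
     smooth_map M N f \<and>
     (\<exists>g. smooth_map N M g \<and>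
        (\<forall>x\<in>topspace (mtop M). g (f x) = x) \<and> (\<forall>y\<in>topspace (mtop N). f (g y) = y))"

definition prod_manifold ::
    "('a, 'e) manifold \<Rightarrow> ('b, 'f) manifold \<Rightarrow> ('a \<times> 'b, 'e \<times> 'f) manifold" where
  "prod_manifold M N =
     \<lparr>mtop = prod_topology (mtop M) (mtop N),
      atlas = {(U \<times> V, map_prod \<phi> \<psi>) |U \<phi> V \<psi>. (U, \<phi>) \<in> atlas M \<and> (V, \<psi>) \<in> atlas N}\<rparr>"


section \<open>Tangent spaces and tangent maps\<close>

instantiation "fun" :: (type, real_vector) real_vector
begin

definition scaleR_fun :: "real \<Rightarrow> ('a \<Rightarrow> 'b) \<Rightarrow> 'a \<Rightarrow> 'b" where
  "scaleR_fun r f = (\<lambda>x. r *\<^sub>R f x)"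

instance
  by standard (simp_all add: scaleR_fun_def fun_eq_iff scaleR_add_left scaleR_add_right)

end

text \<open>A tangent vector at \<open>p\<close> is a family of coordinate vectors, one for each chart around \<open>p\<close>,
  transforming by the derivatives of the transition maps; the entries at all other indices are
  set to \<open>0\<close>. Evaluation at any chart around \<open>p\<close> is an isomorphism onto the model space, and the
  vector space operations are those of the surrounding function type.\<close>

definition tangent_space :: "('a, 'e::real_normed_vector) manifold \<Rightarrow> 'a \<Rightarrow> (('a, 'e) chart \<Rightarrow> 'e) set"
  where
  "tangent_space M p =
     {t. (\<forall>(U, \<phi>)\<in>atlas M. \<forall>(V, \<psi>)\<in>atlas M. p \<in> U \<inter> V \<longrightarrow>
            t (V, \<psi>) = frechet_derivative (\<psi> \<circ> inv_into U \<phi>) (at (\<phi> p)) (t (U, \<phi>))) \<and>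
         (\<forall>c. \<not> (c \<in> atlas M \<and> p \<in> fst c) \<longrightarrow> t c = 0)}"

text \<open>For smooth \<open>f\<close> and \<open>t\<close> in the tangent space, the value does not depend on the
  chart \<open>(U, \<phi>)\<close> chosen around \<open>p\<close>.\<close>

definition tangent_map ::
    "('a, 'e::real_normed_vector) manifold \<Rightarrow> ('b, 'f::real_normed_vector) manifold \<Rightarrow> ('a \<Rightarrow> 'b) \<Rightarrow> 'a
      \<Rightarrow> (('a, 'e) chart \<Rightarrow> 'e) \<Rightarrow> (('b, 'f) chart \<Rightarrow> 'f)"
  where
  "tangent_map M N f p =
     (let (U, \<phi>) = (SOME c. c \<in> atlas M \<and> p \<in> fst c) in
      (\<lambda>t\<in>tangent_space M p. \<lambda>(V, \<psi>).
        if (V, \<psi>) \<in> atlas N \<and> f p \<in> V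
        then frechet_derivative (\<psi> \<circ> f \<circ> inv_into U \<phi>) (at (\<phi> p)) (t (U, \<phi>))
        else 0))"


section \<open>Lie groups\<close>

record ('a, 'e) lie_grp = "'a monoid" +
  mfd :: "('a, 'e) manifold"

locale lie_group = group G for G :: "('a, 'e::real_normed_vector) lie_grp" (structure) +
  assumes smooth_manifold: "smooth_manifold (mfd G)"
    and topspace_eq_carrier: "topspace (mtop (mfd G)) = carrier G"
    and smooth_mult: "smooth_map (prod_manifold (mfd G) (mfd G)) (mfd G) (\<lambda>(x, y). x \<otimes> y)"
    and smooth_inv: "smooth_map (mfd G) (mfd G) (m_inv G)"

text \<open>As with \<^const>\<open>hom\<close>, that \<open>G\<close> and \<open>H\<close> are Lie groups is not part of the following
  predicate.\<close>

definition lie_group_hom ::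
    "('a, 'e::real_normed_vector) lie_grp \<Rightarrow> ('b, 'f::real_normed_vector) lie_grp \<Rightarrow> ('a \<Rightarrow> 'b) \<Rightarrow> bool"
  where
  "lie_group_hom G H f \<longleftrightarrow> f \<in> hom G H \<and> smooth_map (mfd G) (mfd H) f"

definition LieAut :: "('a, 'e::real_normed_vector) lie_grp \<Rightarrow> ('a \<Rightarrow> 'a) monoid" where
  "LieAut H = AutoGroup H \<lparr>carrier := {f \<in> auto H. diffeomorphism (mfd H) (mfd H) f}\<rparr>"

definition lie_algebra :: "('a, 'e::real_normed_vector) lie_grp \<Rightarrow> (('a, 'e) chart \<Rightarrow> 'e) set" where
  "lie_algebra G = tangent_space (mfd G) \<one>\<^bsub>G\<^esub>"

text \<open>Only the underlying vector space of the Lie algebra is used, so no bracket is introduced.\<close>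


section \<open>The general linear group of a finite-dimensional vector space\<close>

text \<open>\<open>V\<close> is a linear subspace of a real vector space. As in \<^const>\<open>BijGroup\<close>, elements of
  \<open>GL(V)\<close> are extensional functions.\<close>

definition linear_autos :: "'v::real_vector set \<Rightarrow> ('v \<Rightarrow> 'v) set" where
  "linear_autos V =
     {A \<in> Bij V. (\<forall>x\<in>V. \<forall>y\<in>V. A (x + y) = A x + A y) \<and> (\<forall>r. \<forall>x\<in>V. A (r *\<^sub>R x) = r *\<^sub>R A x)}"

text \<open>Each linear isomorphism \<open>b\<close> from a finite-dimensional normed space \<open>'e\<close> onto \<open>V\<close> yields a
  global chart \<open>A \<mapsto> b\<^sup>-\<^sup>1 \<circ> A \<circ> b\<close> of \<open>GL(V)\<close>, whose image is the open set of invertible elements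
  of \<open>'e \<Rightarrow>\<^sub>L 'e\<close>. The type argument selects the normed space \<open>'e\<close>; its dimension has to be
  that of \<open>V\<close>.\<close>

definition GL_chart ::
    "'v::real_vector set \<Rightarrow> ('e::real_normed_vector \<Rightarrow> 'v) \<Rightarrow> ('v \<Rightarrow> 'v, 'e \<Rightarrow>\<^sub>L 'e) chart" where
  "GL_chart V b = (linear_autos V, \<lambda>A. Blinfun (inv_into UNIV b \<circ> A \<circ> b))"

definition GL_atlas :: "'v::real_vector set \<Rightarrow> ('v \<Rightarrow> 'v, 'e::real_normed_vector \<Rightarrow>\<^sub>L 'e) chart set" where
  "GL_atlas V = {GL_chart V b |b. linear b \<and> bij_betw b UNIV V}"

text \<open>The topology is the one making the charts homeomorphisms onto their images.\<close>

definition GL :: "'e::real_normed_vector itself \<Rightarrow> 'v::real_vector set \<Rightarrow> ('v \<Rightarrow> 'v, 'e \<Rightarrow>\<^sub>L 'e) lie_grp" where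
  "GL _ V =
     \<lparr>carrier = linear_autos V,
      mult = compose V,
      one = (\<lambda>x\<in>V. x),
      mfd = \<lparr>mtop = topology_generated_by
                {U \<inter> \<phi> -` W |U \<phi> (W :: ('e \<Rightarrow>\<^sub>L 'e) set). (U, \<phi>) \<in> GL_atlas V \<and> open W},
             atlas = GL_atlas V\<rparr>\<rparr>"


section \<open>Actions and relative Rota-Baxter operators\<close>

definition lie_group_action ::
    "('g, 'e::real_normed_vector) lie_grp \<Rightarrow> ('h, 'f::real_normed_vector) lie_grp \<Rightarrow> ('g \<Rightarrow> 'h \<Rightarrow> 'h) \<Rightarrow> bool"
  where
  "lie_group_action G H \<Phi> \<longleftrightarrow>
     \<Phi> \<in> hom G (LieAut H) \<and>
     smooth_map (prod_manifold (mfd G) (mfd H)) (mfd H) (\<lambda>(g, h). \<Phi> g h)"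

definition relative_rota_baxter ::
    "('g, 'e::real_normed_vector) lie_grp \<Rightarrow> ('h, 'f::real_normed_vector) lie_grp \<Rightarrow> ('g \<Rightarrow> 'h \<Rightarrow> 'h)
      \<Rightarrow> ('h \<Rightarrow> 'g) \<Rightarrow> bool"
  where
  "relative_rota_baxter G H \<Phi> B \<longleftrightarrow>
     smooth_map (mfd H) (mfd G) B \<and>
     (\<forall>h1\<in>carrier H. \<forall>h2\<in>carrier H. B h1 \<otimes>\<^bsub>G\<^esub> B h2 = B (h1 \<otimes>\<^bsub>H\<^esub> \<Phi> (B h1) h2))"

definition descendent ::
    "('h, 'f) lie_grp \<Rightarrow> ('g \<Rightarrow> 'h \<Rightarrow> 'h) \<Rightarrow> ('h \<Rightarrow> 'g) \<Rightarrow> ('h, 'f) lie_grp" where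
  "descendent H \<Phi> B = H\<lparr>mult := \<lambda>h1 h2. h1 \<otimes>\<^bsub>H\<^esub> \<Phi> (B h1) h2\<rparr>"

text \<open>The inverse in the descendent group.\<close>

definition dagger ::
    "('g, 'e) lie_grp \<Rightarrow> ('h, 'f) lie_grp \<Rightarrow> ('g \<Rightarrow> 'h \<Rightarrow> 'h) \<Rightarrow> ('h \<Rightarrow> 'g) \<Rightarrow> 'h \<Rightarrow> 'h" where
  "dagger G H \<Phi> B h = \<Phi> (inv\<^bsub>G\<^esub> (B h)) (inv\<^bsub>H\<^esub> h)"

definition Theta ::
    "('g, 'e) lie_grp \<Rightarrow> ('h, 'f) lie_grp \<Rightarrow> ('g \<Rightarrow> 'h \<Rightarrow> 'h) \<Rightarrow> ('h \<Rightarrow> 'g) \<Rightarrow> 'h \<Rightarrow> 'g \<Rightarrow> 'g" where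
  "Theta G H \<Phi> B h g =
     inv\<^bsub>G\<^esub> (B (\<Phi> g (dagger G H \<Phi> B h))) \<otimes>\<^bsub>G\<^esub> g \<otimes>\<^bsub>G\<^esub> B (dagger G H \<Phi> B h)"

end

theory Submission
  imports Defs
begin

text \<open>
  Why the theorem holds. Form the semidirect product of \<open>H\<close> and \<open>G\<close>, with multiplication
  \<open>(h, g) (h', g') = (h \<Phi>(g) h', g g')\<close>. The Rota-Baxter identity says that the graph
  \<open>{(h, B h)}\<close> is a subgroup, and it is isomorphic to the descendent group of \<open>H\<close>. Every element is a
  product of a unique element of this graph and a unique element of \<open>G\<close>. Rewriting
  \<open>(1, g) (k, B k)\<close> in this order gives the element \<open>g \<triangleleft> k = B(\<Phi>(g) k)\<^sup>-\<^sup>1 g B(k)\<close> of \<open>G\<close>, and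
  as \<open>G\<close> is identified with the cosets of the graph, \<open>\<triangleleft>\<close> is a right action of the descendent
  group on the set \<open>G\<close> (\<open>act_star\<close>; the proof there is a direct computation). It fixes the unit. Now
  \<open>\<Theta>(h) g = g \<triangleleft> h\<^sup>\<dagger>\<close>, so \<open>\<Theta>\<close> is a left action by bijections of \<open>G\<close> fixing the unit
  (\<open>Theta_star\<close>, \<open>Theta_inverse\<close>).

  The map \<open>(h, g) \<mapsto> \<Theta>(h) g\<close> is composed of smooth maps (\<open>smooth_Theta\<close>), so each \<open>\<Theta>(h)\<close> is a
  diffeomorphism, and by the chain rule the tangent maps at the unit form a homomorphism into the
  linear automorphisms of the Lie algebra (\<open>tangent_map_compose\<close>, \<open>tangent_map_in_linear_autos\<close>).

  It remains to see that the tangent map depends smoothly on \<open>h\<close>. In charts it is the partial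
  derivative in \<open>g\<close> of a jointly smooth map, applied to a fixed vector; this is smooth in \<open>h\<close>
  (\<open>smooth_on_parameter_derivative\<close>). A family of operators on a finite-dimensional space whose
  values on each vector are smooth is smooth in the operator norm (\<open>smooth_on_Blinfun\<close>), and a
  change of basis of the Lie algebra only conjugates the family by a constant
  (\<open>smooth_map_into_GL\<close>).

  The calculus behind this rests on the chain rule for maps of class \<open>C\<^sup>n\<close>, with derivatives taken
  in constant directions (\<open>Ck_on_compose\<close>).
\<close>


section \<open>Finite-dimensional normed spaces\<close>

text \<open>Induction on the set. By the induction hypothesis the coefficients of a convergent sequence in
  the span are Cauchy sequences, so the span is closed and the new vector has positive distance
  \<open>d\<close> from it. Hence the new coefficient is at most \<open>1 / d\<close> times the norm, and
  the old ones are bounded through the induction hypothesis for the rest of the sum.\<close>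

lemma coefficients_bounded_by_norm:
  fixes S :: "'e::real_normed_vector set"
  assumes "finite S" "independent S"
  shows "\<exists>C. \<forall>a. (\<Sum>b\<in>S. \<bar>a b\<bar>) \<le> C * norm (\<Sum>b\<in>S. a b *\<^sub>R b)"
  using assms
proof (induction S rule: finite_induct)
  case empty
  show ?case by (intro exI[of _ 0]) auto
next
  case (insert x S)
  from insert.prems have ind: "independent S" and x: "x \<notin> span S"
    using insert.hyps by (auto simp: independent_insert)
  from insert.IH[OF ind] obtain C where C: "\<And>a. (\<Sum>b\<in>S. \<bar>a b\<bar>) \<le> C * norm (\<Sum>b\<in>S. a b *\<^sub>R b)"
    by blast
  have "closed (span S)"
    unfolding closed_sequential_limits
  proof (intro allI impI, elim conjE)
    fix s l assume s: "\<forall>n. s n \<in> span S" and l: "s \<longlonglongrightarrow> l"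
    from s have "\<forall>n. \<exists>a. s n = (\<Sum>b\<in>S. a b *\<^sub>R b)"
      by (auto simp: span_finite[OF insert.hyps(1)])
    from choice[OF this] obtain a where a: "\<And>n. s n = (\<Sum>b\<in>S. a n b *\<^sub>R b)" by blast
    have Cauchy_s: "Cauchy s" using l by (rule LIMSEQ_imp_Cauchy)
    have "\<exists>L. (\<lambda>n. a n b) \<longlonglongrightarrow> L" if b: "b \<in> S" for b
    proof -
      have le: "\<bar>a m b - a n b\<bar> \<le> \<bar>C\<bar> * norm (s m - s n)" for m n
      proof -
        have "\<bar>a m b - a n b\<bar> \<le> (\<Sum>b\<in>S. \<bar>a m b - a n b\<bar>)"
          using insert.hyps(1) b by (intro member_le_sum) auto
        also have "\<dots> \<le> C * norm (\<Sum>b\<in>S. (a m b - a n b) *\<^sub>R b)"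
          by (rule C)
        also have "(\<Sum>b\<in>S. (a m b - a n b) *\<^sub>R b) = s m - s n"
          by (simp add: a scaleR_left_diff_distrib sum_subtractf)
        also have "C * norm (s m - s n) \<le> \<bar>C\<bar> * norm (s m - s n)"
          by (intro mult_right_mono) auto
        finally show ?thesis .
      qed
      have "Cauchy (\<lambda>n. a n b)"
      proof (rule metric_CauchyI)
        fix e :: real assume e: "e > 0"
        then have "e / (\<bar>C\<bar> + 1) > 0" by (simp add: add_nonneg_pos)
        then obtain M where M: "\<And>m n. m \<ge> M \<Longrightarrow> n \<ge> M \<Longrightarrow> dist (s m) (s n) < e / (\<bar>C\<bar> + 1)"
          using Cauchy_s unfolding Cauchy_def by meson
        have "dist (a m b) (a n b) < e" if "m \<ge> M" "n \<ge> M" for m n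
        proof -
          have "dist (a m b) (a n b) \<le> \<bar>C\<bar> * dist (s m) (s n)"
            using le[of m n] by (simp add: dist_norm)
          also have "\<dots> \<le> (\<bar>C\<bar> + 1) * dist (s m) (s n)"
            by (intro mult_right_mono) auto
          also have "\<dots> < e"
            using M[OF that] by (simp add: field_simps add_nonneg_pos)
          finally show ?thesis .
        qed
        then show "\<exists>M. \<forall>m\<ge>M. \<forall>n\<ge>M. dist (a m b) (a n b) < e" by blast
      qed
      then show ?thesis using Cauchy_convergent_iff convergent_def by blast
    qed
    then obtain L where L: "\<And>b. b \<in> S \<Longrightarrow> (\<lambda>n. a n b) \<longlonglongrightarrow> L b" by metis
    have "s \<longlonglongrightarrow> (\<Sum>b\<in>S. L b *\<^sub>R b)"
      unfolding a by (intro tendsto_sum tendsto_scaleR L tendsto_const)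
    then have "l = (\<Sum>b\<in>S. L b *\<^sub>R b)" using l LIMSEQ_unique by blast
    then show "l \<in> span S" by (simp add: span_sum span_scale span_base)
  qed
  then have "open (- span S)" by (rule open_Compl)
  \<comment> \<open>The number \<open>d\<close> bounds the distance from the new vector to the span from below.\<close>
  then obtain d where "d > 0" and ball: "ball x d \<subseteq> - span S"
    using x openE[of "- span S" x] by blast
  then have d: "d > 0" "\<And>y. y \<in> span S \<Longrightarrow> d \<le> dist x y"
    by (auto simp: subset_iff not_less[symmetric])
  have "(\<Sum>b\<in>insert x S. \<bar>a b\<bar>) \<le> (1 / d + \<bar>C\<bar> * (1 + norm x / d)) * norm (\<Sum>b\<in>insert x S. a b *\<^sub>R b)" for a
  proof -
    define s where "s = (\<Sum>b\<in>S. a b *\<^sub>R b)"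
    define N where "N = norm (a x *\<^sub>R x + s)"
    have s: "s \<in> span S" unfolding s_def by (simp add: span_sum span_scale span_base)
    have ax: "\<bar>a x\<bar> * d \<le> N"
    proof (cases "a x = 0")
      case False
      have "d \<le> dist x (- (1 / a x) *\<^sub>R s)"
        using s by (intro d(2)) (rule span_scale)
      then have "\<bar>a x\<bar> * d \<le> \<bar>a x\<bar> * norm (x + (1 / a x) *\<^sub>R s)"
        by (intro mult_left_mono) (auto simp: dist_norm)
      also have "\<dots> = norm (a x *\<^sub>R (x + (1 / a x) *\<^sub>R s))" by simp
      also have "\<dots> = N" using False by (simp add: N_def scaleR_add_right)
      finally show ?thesis .
    qed (simp add: N_def)
    then have ax': "\<bar>a x\<bar> \<le> N / d" using d(1) by (simp add: field_simps)
    have "norm s \<le> N + \<bar>a x\<bar> * norm x"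
      using norm_triangle_ineq4[of "a x *\<^sub>R x + s" "a x *\<^sub>R x"] by (simp add: N_def)
    also have "\<dots> \<le> N + N / d * norm x"
      using ax' by (intro add_left_mono mult_right_mono) auto
    finally have s_le: "norm s \<le> (1 + norm x / d) * N" by (simp add: algebra_simps)
    have "(\<Sum>b\<in>S. \<bar>a b\<bar>) \<le> C * norm s" unfolding s_def by (rule C)
    also have "\<dots> \<le> \<bar>C\<bar> * norm s" by (intro mult_right_mono) auto
    also have "\<dots> \<le> \<bar>C\<bar> * ((1 + norm x / d) * N)" by (intro mult_left_mono s_le) auto
    finally have "\<bar>a x\<bar> + (\<Sum>b\<in>S. \<bar>a b\<bar>) \<le> N / d + \<bar>C\<bar> * ((1 + norm x / d) * N)"
      using ax' by linarith
    then show ?thesis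
      using insert.hyps by (simp add: s_def N_def algebra_simps)
  qed
  then show ?case by blast
qed

text \<open>The coordinate functionals of a basis are the tool by which finite dimension is used below:
  they are continuous, so vectors may be expanded in smoothly varying coordinates.\<close>

lemma finite_dim_coordinates:
  assumes "finite_dim TYPE('e::real_normed_vector)"
  obtains B and c :: "'e::real_normed_vector \<Rightarrow> 'e \<Rightarrow> real"
  where "finite B" "\<And>b. b \<in> B \<Longrightarrow> bounded_linear (c b)" "\<And>x. (\<Sum>b\<in>B. c b x *\<^sub>R b) = x"
proof -
  from assms obtain B0 :: "'e set" where B0: "finite B0" "span B0 = UNIV"
    unfolding finite_dim_def by blast
  obtain B where B: "B \<subseteq> B0" "independent B" "B0 \<subseteq> span B"
    using maximal_independent_subset[of B0] by blast
  have fin: "finite B" using B(1) B0(1) finite_subset by blast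
  have spB: "span B = UNIV"
    using span_minimal[OF B(3) subspace_span] B0(2) by auto
  define c where "c b x = representation B x b" for b x
  have sum: "(\<Sum>b\<in>B. c b x *\<^sub>R b) = x" for x
    unfolding c_def using B(2) fin spB by (intro sum_representation_eq) auto
  obtain C where C: "\<And>a. (\<Sum>b\<in>B. \<bar>a b\<bar>) \<le> C * norm (\<Sum>b\<in>B. a b *\<^sub>R b)"
    using coefficients_bounded_by_norm[OF fin B(2)] by blast
  have "bounded_linear (c b)" if b: "b \<in> B" for b
  proof (rule bounded_linear_intro)
    show "c b (x + y) = c b x + c b y" for x y
      unfolding c_def using B(2) spB by (simp add: representation_add)
    show "c b (r *\<^sub>R x) = r *\<^sub>R c b x" for r x
      unfolding c_def using B(2) spB by (simp add: representation_scale)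
    show "norm (c b x) \<le> norm x * C" for x
    proof -
      have "\<bar>c b x\<bar> \<le> (\<Sum>b\<in>B. \<bar>c b x\<bar>)" using fin b by (intro member_le_sum) auto
      also have "\<dots> \<le> C * norm (\<Sum>b\<in>B. c b x *\<^sub>R b)" by (rule C)
      finally show ?thesis by (simp add: sum mult.commute)
    qed
  qed
  with fin sum show ?thesis using that by blast
qed

lemma linear_finite_dim_bounded:
  fixes f :: "'e::real_normed_vector \<Rightarrow> 'f::real_normed_vector"
  assumes "finite_dim TYPE('e)" "linear f"
  shows "bounded_linear f"
proof -
  obtain B and c :: "'e \<Rightarrow> 'e \<Rightarrow> real"
    where B: "finite B" "\<And>b. b \<in> B \<Longrightarrow> bounded_linear (c b)" "\<And>x. (\<Sum>b\<in>B. c b x *\<^sub>R b) = x"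
    using finite_dim_coordinates[OF assms(1)] by blast
  have "f x = (\<Sum>b\<in>B. c b x *\<^sub>R f b)" for x
  proof -
    have "f x = f (\<Sum>b\<in>B. c b x *\<^sub>R b)" by (simp add: B(3))
    also have "\<dots> = (\<Sum>b\<in>B. c b x *\<^sub>R f b)"
      using assms(2) by (simp add: linear_sum linear_cmul)
    finally show ?thesis .
  qed
  then have "f = (\<lambda>x. \<Sum>b\<in>B. c b x *\<^sub>R f b)" by blast
  moreover have "bounded_linear (\<lambda>x. \<Sum>b\<in>B. c b x *\<^sub>R f b)"
    by (intro bounded_linear_sum bounded_linear_compose[OF bounded_linear_scaleR_left] B(2))
  ultimately show ?thesis by simp
qed

lemma finite_dim_prod:
  assumes "finite_dim TYPE('a::real_vector)" "finite_dim TYPE('b::real_vector)"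
  shows "finite_dim TYPE('a \<times> 'b)"
proof -
  obtain A :: "'a set" where A: "finite A" "span A = UNIV" using assms(1) unfolding finite_dim_def by blast
  obtain B :: "'b set" where B: "finite B" "span B = UNIV" using assms(2) unfolding finite_dim_def by blast
  let ?l = "\<lambda>x. (x, 0) :: 'a \<times> 'b" and ?r = "\<lambda>y. (0, y) :: 'a \<times> 'b"
  have l: "linear ?l" and r: "linear ?r" by (auto intro!: linearI)
  have "z \<in> span (?l ` A \<union> ?r ` B)" for z
  proof -
    have "?l (fst z) \<in> span (?l ` A)" "?r (snd z) \<in> span (?r ` B)"
      using A(2) B(2) linear_span_image[OF l] linear_span_image[OF r] by auto
    then have "?l (fst z) + ?r (snd z) \<in> span (?l ` A \<union> ?r ` B)"
      by (intro span_add) (meson span_mono subsetD Un_upper1 Un_upper2)+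
    then show ?thesis by simp
  qed
  then show ?thesis unfolding finite_dim_def
    using A(1) B(1) by (intro exI[of _ "?l ` A \<union> ?r ` B"]) auto
qed


section \<open>Calculus of smooth maps\<close>

lemma Ck_on_cong:
  assumes "open S" "\<And>x. x \<in> S \<Longrightarrow> f x = g x" "Ck_on n S f"
  shows "Ck_on n S g"
  using assms(2,3)
proof (induction n arbitrary: f g)
  case 0
  then show ?case by (metis Ck_on.simps(1) continuous_on_cong)
next
  case (Suc n)
  have der: "(g has_derivative frechet_derivative f (at x)) (at x)" if x: "x \<in> S" for x
  proof (rule has_derivative_transform_within_open[OF _ assms(1) x])
    show "(f has_derivative frechet_derivative f (at x)) (at x)"
      using Suc.prems(2) x by (simp add: frechet_derivative_works)
    show "f y = g y" if "y \<in> S" for y using that by (rule Suc.prems(1))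
  qed
  have eq: "frechet_derivative f (at x) = frechet_derivative g (at x)" if "x \<in> S" for x
    using frechet_derivative_at[OF der[OF that]] .
  show ?case
  proof (simp, intro conjI ballI allI)
    show "g differentiable at x" if "x \<in> S" for x using der[OF that] by (rule differentiableI)
    show "Ck_on n S (\<lambda>x. frechet_derivative g (at x) v)" for v
      using Suc.IH[of "\<lambda>x. frechet_derivative f (at x) v" "\<lambda>x. frechet_derivative g (at x) v"]
        Suc.prems eq by simp
  qed
qed

lemma Ck_on_subset: "Ck_on n S f \<Longrightarrow> T \<subseteq> S \<Longrightarrow> Ck_on n T f"
  by (induction n arbitrary: f) (auto intro: continuous_on_subset)

lemma Ck_on_Union:
  "(\<And>T. T \<in> F \<Longrightarrow> open T \<and> Ck_on n T f) \<Longrightarrow> Ck_on n (\<Union>F) f"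
proof (induction n arbitrary: f)
  case 0
  then show ?case by (auto intro: continuous_on_open_Union)
next
  case (Suc n)
  then show ?case by auto
qed

text \<open>Since \<open>C\<^sup>n\<^sup>+\<^sup>1\<close> is defined through the derivative alone, continuity at the bottom has to come from
  differentiability.\<close>

lemma Ck_on_Suc_imp: "Ck_on (Suc n) S f \<Longrightarrow> Ck_on n S f"
proof (induction n arbitrary: f)
  case 0
  then show ?case
    by (simp add: continuous_at_imp_continuous_on differentiable_imp_continuous_within)
next
  case (Suc n)
  have "f differentiable at x" if "x \<in> S" for x using Suc.prems that by simp
  moreover have "Ck_on n S (\<lambda>x. frechet_derivative f (at x) v)" for v
    using Suc.prems by (intro Suc.IH) simp
  ultimately show ?case by simp
qed

lemma Ck_on_const: "Ck_on n S (\<lambda>x. k)"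
  by (induction n arbitrary: k) auto

lemma Ck_on_bounded_linear:
  assumes "bounded_linear L"
  shows "Ck_on n S L"
proof (cases n)
  case 0
  then show ?thesis using assms by (simp add: linear_continuous_on)
next
  case (Suc m)
  have "frechet_derivative L (at x) = L" for x
    using frechet_derivative_at[OF bounded_linear_imp_has_derivative[OF assms]] by simp
  then show ?thesis
    using Suc assms by (auto simp: Ck_on_const intro: bounded_linear_imp_differentiable)
qed

text \<open>The inductions on the order below have as their step a formula for the derivative; this rule
  takes that formula as \<open>f'\<close>.\<close>

lemma Ck_on_Suc_I:
  assumes "open S" "\<And>x. x \<in> S \<Longrightarrow> (f has_derivative f' x) (at x)"
    and "\<And>v. Ck_on n S (\<lambda>x. f' x v)"
  shows "Ck_on (Suc n) S f"
proof -
  have "f' x = frechet_derivative f (at x)" if "x \<in> S" for x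
    using frechet_derivative_at[OF assms(2)[OF that]] .
  then have "Ck_on n S (\<lambda>x. frechet_derivative f (at x) v)" for v
    by (intro Ck_on_cong[OF assms(1) _ assms(3)]) simp
  then show ?thesis using assms(2) by (auto intro: differentiableI)
qed

lemma Ck_on_Suc_has_derivative:
  "Ck_on (Suc n) S f \<Longrightarrow> x \<in> S \<Longrightarrow> (f has_derivative frechet_derivative f (at x)) (at x)"
  by (simp add: frechet_derivative_works)

lemma Ck_on_add:
  assumes "open S" "Ck_on n S f" "Ck_on n S g"
  shows "Ck_on n S (\<lambda>x. f x + g x)"
  using assms(2,3)
proof (induction n arbitrary: f g)
  case 0
  then show ?case by (auto intro: continuous_on_add)
next
  case (Suc n)
  show ?case
  proof (rule Ck_on_Suc_I[OF assms(1)])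
    show "((\<lambda>x. f x + g x) has_derivative
        (\<lambda>v. frechet_derivative f (at x) v + frechet_derivative g (at x) v)) (at x)" if "x \<in> S" for x
      by (rule has_derivative_add[OF Ck_on_Suc_has_derivative[OF Suc.prems(1) that]
            Ck_on_Suc_has_derivative[OF Suc.prems(2) that]])
    show "Ck_on n S (\<lambda>x. frechet_derivative f (at x) v + frechet_derivative g (at x) v)" for v
      using Suc.prems by (intro Suc.IH) auto
  qed
qed

lemma Ck_on_sum:
  assumes "open S" "\<And>b. b \<in> B \<Longrightarrow> Ck_on n S (f b)"
  shows "Ck_on n S (\<lambda>x. \<Sum>b\<in>B. f b x)"
  using assms(2)
proof (induction B rule: infinite_finite_induct)
  case (insert b B)
  then have "Ck_on n S (\<lambda>x. f b x + (\<Sum>b\<in>B. f b x))"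
    by (intro Ck_on_add[OF assms(1)]) blast+
  with insert.hyps show ?case by simp
qed (simp_all add: Ck_on_const)

lemma Ck_on_bounded_linear_comp:
  assumes "open S" "bounded_linear L" "Ck_on n S f"
  shows "Ck_on n S (\<lambda>x. L (f x))"
  using assms(3)
proof (induction n arbitrary: f)
  case 0
  then show ?case by (auto intro: bounded_linear.continuous_on[OF assms(2)])
next
  case (Suc n)
  show ?case
  proof (rule Ck_on_Suc_I[OF assms(1)])
    show "((\<lambda>x. L (f x)) has_derivative (\<lambda>v. L (frechet_derivative f (at x) v))) (at x)"
      if "x \<in> S" for x
      by (rule bounded_linear.has_derivative[OF assms(2) Ck_on_Suc_has_derivative[OF Suc.prems that]])
    show "Ck_on n S (\<lambda>x. L (frechet_derivative f (at x) v))" for v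
      using Suc.prems by (intro Suc.IH) simp
  qed
qed

lemma Ck_on_scaleR:
  fixes f :: "'a::real_normed_vector \<Rightarrow> real"
  assumes "open S" "Ck_on n S f" "Ck_on n S g"
  shows "Ck_on n S (\<lambda>x. f x *\<^sub>R g x)"
  using assms(2,3)
proof (induction n arbitrary: f g)
  case 0
  then show ?case by (auto intro: continuous_on_scaleR)
next
  case (Suc n)
  show ?case
  proof (rule Ck_on_Suc_I[OF assms(1)])
    fix x assume x: "x \<in> S"
    show "((\<lambda>x. f x *\<^sub>R g x) has_derivative (\<lambda>v. f x *\<^sub>R frechet_derivative g (at x) v
        + frechet_derivative f (at x) v *\<^sub>R g x)) (at x)"
      by (rule has_derivative_scaleR[OF Ck_on_Suc_has_derivative[OF Suc.prems(1) x]
            Ck_on_Suc_has_derivative[OF Suc.prems(2) x]])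
  next
    fix v
    have "Ck_on n S (\<lambda>x. frechet_derivative f (at x) v)" "Ck_on n S (\<lambda>x. frechet_derivative g (at x) v)"
      using Suc.prems by auto
    then show "Ck_on n S (\<lambda>x. f x *\<^sub>R frechet_derivative g (at x) v
        + frechet_derivative f (at x) v *\<^sub>R g x)"
      using Ck_on_Suc_imp[OF Suc.prems(1)] Ck_on_Suc_imp[OF Suc.prems(2)]
      by (intro Ck_on_add[OF assms(1)] Suc.IH)
  qed
qed

text \<open>The chain rule gives \<open>Dg(f x)(Df(x) v)\<close>, where both the base point and the direction depend on
  \<open>x\<close>, so the induction hypothesis does not apply directly. Expanding the direction in a basis of
  the middle space turns this into the finite sum of \<open>c\<^sub>b(Df(x) v) Dg(f x) b\<close>, in which every
  direction is constant. This is where that space has to be finite-dimensional.\<close>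

lemma Ck_on_compose:
  fixes f :: "'a::real_normed_vector \<Rightarrow> 'b::real_normed_vector"
    and g :: "'b \<Rightarrow> 'c::real_normed_vector"
  assumes "finite_dim TYPE('b)" "open S" "f ` S \<subseteq> T" "Ck_on n T g" "Ck_on n S f"
  shows "Ck_on n S (\<lambda>x. g (f x))"
  using assms(4,5)
proof (induction n arbitrary: g)
  case 0
  then show ?case using assms(3) by (auto intro: continuous_on_compose2)
next
  case (Suc n)
  obtain B and c :: "'b \<Rightarrow> 'b \<Rightarrow> real"
    where B: "finite B" "\<And>b. b \<in> B \<Longrightarrow> bounded_linear (c b)" "\<And>y. (\<Sum>b\<in>B. c b y *\<^sub>R b) = y"
    using finite_dim_coordinates[OF assms(1)] by blast
  let ?f' = "\<lambda>x. frechet_derivative f (at x)" and ?g' = "\<lambda>y. frechet_derivative g (at y)"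
  show ?case
  proof (rule Ck_on_Suc_I[OF assms(2)])
    fix x assume x: "x \<in> S"
    have f': "(f has_derivative ?f' x) (at x)"
      using Suc.prems(2) x by (rule Ck_on_Suc_has_derivative)
    have g': "(g has_derivative ?g' (f x)) (at (f x))"
      using Suc.prems(1) x assms(3) by (intro Ck_on_Suc_has_derivative) auto
    have lin: "linear (?g' (f x))" using g' by (rule has_derivative_linear)
    have "?g' (f x) w = (\<Sum>b\<in>B. c b w *\<^sub>R ?g' (f x) b)" for w
    proof -
      have "?g' (f x) w = ?g' (f x) (\<Sum>b\<in>B. c b w *\<^sub>R b)" by (simp only: B(3))
      also have "\<dots> = (\<Sum>b\<in>B. c b w *\<^sub>R ?g' (f x) b)"
        by (simp add: linear_sum[OF lin] linear_cmul[OF lin])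
      finally show ?thesis .
    qed
    then have "(\<lambda>v. ?g' (f x) (?f' x v)) = (\<lambda>v. \<Sum>b\<in>B. c b (?f' x v) *\<^sub>R ?g' (f x) b)"
      by (intro ext)
    then show "((\<lambda>x. g (f x)) has_derivative (\<lambda>v. \<Sum>b\<in>B. c b (?f' x v) *\<^sub>R ?g' (f x) b)) (at x)"
      using has_derivative_compose[OF f' g'] by simp
  next
    fix v
    show "Ck_on n S (\<lambda>x. \<Sum>b\<in>B. c b (?f' x v) *\<^sub>R ?g' (f x) b)"
    proof (intro Ck_on_sum[OF assms(2)] Ck_on_scaleR[OF assms(2)])
      fix b assume b: "b \<in> B"
      have "Ck_on n S (\<lambda>x. ?f' x v)" using Suc.prems(2) by simp
      then show "Ck_on n S (\<lambda>x. c b (?f' x v))"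
        by (rule Ck_on_bounded_linear_comp[OF assms(2) B(2)[OF b]])
      have "Ck_on n T (\<lambda>y. ?g' y b)" using Suc.prems(1) by simp
      then show "Ck_on n S (\<lambda>x. ?g' (f x) b)"
        using Ck_on_Suc_imp[OF Suc.prems(2)] by (rule Suc.IH)
    qed
  qed
qed

lemma Ck_on_Pair:
  assumes "open S" "Ck_on n S f" "Ck_on n S g"
  shows "Ck_on n S (\<lambda>x. (f x, g x))"
proof -
  have "Ck_on n S (\<lambda>x. (f x, 0) + (0, g x))"
    by (intro Ck_on_add assms(1)
        Ck_on_bounded_linear_comp[OF assms(1) _ assms(2), of "\<lambda>y. (y, 0)"]
        Ck_on_bounded_linear_comp[OF assms(1) _ assms(3), of "\<lambda>y. (0, y)"]
        bounded_linear_Pair bounded_linear_ident bounded_linear_zero)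
  then show ?thesis by simp
qed

lemma smooth_on_differentiable:
  "smooth_on S f \<Longrightarrow> x \<in> S \<Longrightarrow> f differentiable at x"
  unfolding smooth_on_def by (metis Ck_on.simps(2))

lemma smooth_on_frechet_derivative:
  "smooth_on S f \<Longrightarrow> smooth_on S (\<lambda>x. frechet_derivative f (at x) v)"
  unfolding smooth_on_def by (metis Ck_on.simps(2))

lemma smooth_on_imp_continuous_on: "smooth_on S f \<Longrightarrow> continuous_on S f"
  unfolding smooth_on_def by (metis Ck_on.simps(1))

lemma smooth_on_cong:
  assumes "open S" "\<And>x. x \<in> S \<Longrightarrow> f x = g x" "smooth_on S f"
  shows "smooth_on S g"
  using assms Ck_on_cong unfolding smooth_on_def by blast

lemma smooth_on_subset: "smooth_on S f \<Longrightarrow> T \<subseteq> S \<Longrightarrow> smooth_on T f"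
  unfolding smooth_on_def using Ck_on_subset by blast

text \<open>Chart representatives of a composition factor through a chart of the middle manifold only near
  each point, so smoothness has to be assembled from small open sets.\<close>

lemma smooth_on_local:
  assumes "\<And>x. x \<in> S \<Longrightarrow> \<exists>T. open T \<and> x \<in> T \<and> T \<subseteq> S \<and> smooth_on T f"
  shows "smooth_on S f"
proof -
  let ?F = "{T. open T \<and> T \<subseteq> S \<and> smooth_on T f}"
  have "\<Union>?F = S" using assms by blast
  moreover have "Ck_on n (\<Union>?F) f" for n
    by (rule Ck_on_Union) (auto simp: smooth_on_def)
  ultimately show ?thesis by (simp add: smooth_on_def)
qed

lemma smooth_on_compose:
  fixes f :: "'a::real_normed_vector \<Rightarrow> 'b::real_normed_vector"
    and g :: "'b \<Rightarrow> 'c::real_normed_vector"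
  assumes "finite_dim TYPE('b)" "open S" "f ` S \<subseteq> T" "smooth_on T g" "smooth_on S f"
  shows "smooth_on S (\<lambda>x. g (f x))"
  using Ck_on_compose[OF assms(1-3)] assms(4,5) unfolding smooth_on_def by blast

lemma smooth_on_Pair:
  "open S \<Longrightarrow> smooth_on S f \<Longrightarrow> smooth_on S g \<Longrightarrow> smooth_on S (\<lambda>x. (f x, g x))"
  unfolding smooth_on_def by (blast intro: Ck_on_Pair)

lemma smooth_on_const: "smooth_on S (\<lambda>x. k)"
  unfolding smooth_on_def by (blast intro: Ck_on_const)

lemma smooth_on_bounded_linear: "bounded_linear L \<Longrightarrow> smooth_on S L"
  unfolding smooth_on_def by (blast intro: Ck_on_bounded_linear)

lemma smooth_on_bounded_linear_comp:
  "open S \<Longrightarrow> bounded_linear L \<Longrightarrow> smooth_on S f \<Longrightarrow> smooth_on S (\<lambda>x. L (f x))"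
  unfolding smooth_on_def by (blast intro: Ck_on_bounded_linear_comp)

lemma smooth_on_sum:
  "open S \<Longrightarrow> (\<And>b. b \<in> B \<Longrightarrow> smooth_on S (f b)) \<Longrightarrow> smooth_on S (\<lambda>x. \<Sum>b\<in>B. f b x)"
  unfolding smooth_on_def by (blast intro: Ck_on_sum)

text \<open>A family of operators is the sum of the rank-one operators \<open>v \<mapsto> c\<^sub>b(v) A(x)b\<close>, each of which
  depends linearly on the vector \<open>A(x)b\<close>. Hence smoothness in the operator norm can be tested
  on vectors.\<close>

lemma smooth_on_Blinfun:
  fixes A :: "'a::real_normed_vector \<Rightarrow> 'e::real_normed_vector \<Rightarrow> 'f::real_normed_vector"
  assumes fd: "finite_dim TYPE('e)" and S: "open S"
    and lin: "\<And>x. x \<in> S \<Longrightarrow> linear (A x)"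
    and sm: "\<And>v. smooth_on S (\<lambda>x. A x v)"
  shows "smooth_on S (\<lambda>x. Blinfun (A x))"
proof -
  obtain B and c :: "'e \<Rightarrow> 'e \<Rightarrow> real"
    where B: "finite B" "\<And>b. b \<in> B \<Longrightarrow> bounded_linear (c b)" "\<And>y. (\<Sum>b\<in>B. c b y *\<^sub>R b) = y"
    using finite_dim_coordinates[OF fd] by blast
  define R where "R b w = blinfun_scaleR_left w o\<^sub>L Blinfun (c b)" for b and w :: 'f
  have R_apply: "blinfun_apply (R b w) v = c b v *\<^sub>R w" if "b \<in> B" for b w v
    using B(2)[OF that] by (simp add: R_def bounded_linear_Blinfun_apply)
  have R: "bounded_linear (R b)" for b
    unfolding R_def by (intro bounded_linear_intros)
  have "Blinfun (A x) = (\<Sum>b\<in>B. R b (A x b))" if x: "x \<in> S" for x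
  proof (rule blinfun_eqI)
    fix v
    have "blinfun_apply (Blinfun (A x)) v = A x (\<Sum>b\<in>B. c b v *\<^sub>R b)"
      using linear_finite_dim_bounded[OF fd lin[OF x]]
      by (simp add: bounded_linear_Blinfun_apply B(3))
    also have "\<dots> = (\<Sum>b\<in>B. c b v *\<^sub>R A x b)"
      using lin[OF x] by (simp add: linear_sum linear_cmul)
    also have "\<dots> = blinfun_apply (\<Sum>b\<in>B. R b (A x b)) v"
      by (simp add: blinfun.sum_left R_apply)
    finally show "blinfun_apply (Blinfun (A x)) v = blinfun_apply (\<Sum>b\<in>B. R b (A x b)) v" .
  qed
  moreover have "smooth_on S (\<lambda>x. \<Sum>b\<in>B. R b (A x b))"
    by (intro smooth_on_sum[OF S] smooth_on_bounded_linear_comp[OF S R] sm)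
  ultimately show ?thesis using smooth_on_cong[OF S, of "\<lambda>x. \<Sum>b\<in>B. R b (A x b)"] by simp
qed


section \<open>Smooth maps between manifolds\<close>

text \<open>Maps on products of manifolds are handled only through chart representatives. For these it
  matters that the charts cover the space and are homeomorphisms onto open sets, which products
  inherit chart by chart.\<close>

definition locally_euclidean :: "('a, 'e::real_normed_vector) manifold \<Rightarrow> bool" where
  "locally_euclidean M \<longleftrightarrow>
     finite_dim TYPE('e) \<and> (\<Union>(U, \<phi>)\<in>atlas M. U) = topspace (mtop M) \<and>
     (\<forall>(U, \<phi>)\<in>atlas M. openin (mtop M) U \<and> open (\<phi> ` U) \<and>
        homeomorphic_map (subtopology (mtop M) U) (top_of_set (\<phi> ` U)) \<phi>)"

lemma smooth_manifold_imp_locally_euclidean: "smooth_manifold M \<Longrightarrow> locally_euclidean M"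
  unfolding smooth_manifold_def locally_euclidean_def by auto

lemma locally_euclidean_finite_dim:
  fixes M :: "('a, 'e::real_normed_vector) manifold"
  shows "locally_euclidean M \<Longrightarrow> finite_dim TYPE('e)"
  unfolding locally_euclidean_def by blast

lemma chart_around:
  assumes "locally_euclidean M" "p \<in> topspace (mtop M)"
  obtains U \<phi> where "(U, \<phi>) \<in> atlas M" "p \<in> U"
  using assms unfolding locally_euclidean_def by fast

lemma chart_openin:
  "locally_euclidean M \<Longrightarrow> (U, \<phi>) \<in> atlas M \<Longrightarrow> openin (mtop M) U"
  unfolding locally_euclidean_def by blast

lemma chart_subset:
  "locally_euclidean M \<Longrightarrow> (U, \<phi>) \<in> atlas M \<Longrightarrow> U \<subseteq> topspace (mtop M)"
  using chart_openin openin_subset by blast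

lemma chart_homeomorphic:
  "locally_euclidean M \<Longrightarrow> (U, \<phi>) \<in> atlas M \<Longrightarrow>
    homeomorphic_map (subtopology (mtop M) U) (top_of_set (\<phi> ` U)) \<phi>"
  unfolding locally_euclidean_def by blast

lemma chart_inj_on:
  assumes "locally_euclidean M" "(U, \<phi>) \<in> atlas M"
  shows "inj_on \<phi> U"
proof -
  have "topspace (subtopology (mtop M) U) = U"
    using chart_subset[OF assms] by auto
  then show ?thesis
    using homeomorphic_imp_injective_map[OF chart_homeomorphic[OF assms]] by simp
qed

lemma chart_inverse [simp]:
  "locally_euclidean M \<Longrightarrow> (U, \<phi>) \<in> atlas M \<Longrightarrow> p \<in> U \<Longrightarrow> inv_into U \<phi> (\<phi> p) = p"
  using chart_inj_on inv_into_f_f by metis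

lemma chart_range_open:
  "locally_euclidean M \<Longrightarrow> (U, \<phi>) \<in> atlas M \<Longrightarrow> open (\<phi> ` U)"
  unfolding locally_euclidean_def by blast

lemma chart_image_open:
  assumes M: "locally_euclidean M" "(U, \<phi>) \<in> atlas M" and W: "openin (mtop M) W"
  shows "open (\<phi> ` (U \<inter> W))"
proof -
  have "openin (top_of_set (\<phi> ` U)) (\<phi> ` (U \<inter> W))"
    using homeomorphic_imp_open_map[OF chart_homeomorphic[OF M]] openin_subtopology_Int2[OF W]
    unfolding open_map_def by blast
  then show ?thesis using chart_range_open[OF M] openin_open_trans by blast
qed

lemma chart_image_open_vimage:
  assumes M: "locally_euclidean M" "(U, \<phi>) \<in> atlas M"
    and f: "continuous_map (mtop M) X f" and W: "openin X W"
  shows "open (\<phi> ` (U \<inter> f -` W))"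
proof -
  have "U \<inter> f -` W = U \<inter> {x \<in> topspace (mtop M). f x \<in> W}"
    using chart_subset[OF M] by auto
  then show ?thesis
    using chart_image_open[OF M openin_continuous_map_preimage[OF f W]] by simp
qed

lemma smooth_map_continuous: "smooth_map M N f \<Longrightarrow> continuous_map (mtop M) (mtop N) f"
  unfolding smooth_map_def by blast

lemma smooth_map_charts:
  "smooth_map M N f \<Longrightarrow> (U, \<phi>) \<in> atlas M \<Longrightarrow> (V, \<psi>) \<in> atlas N \<Longrightarrow>
    smooth_on (\<phi> ` (U \<inter> f -` V)) (\<lambda>x. \<psi> (f (inv_into U \<phi> x)))"
  unfolding smooth_map_def by (auto simp: o_def)

lemma smooth_mapI:
  assumes "continuous_map (mtop M) (mtop N) f"
    and "\<And>U \<phi> V \<psi>. (U, \<phi>) \<in> atlas M \<Longrightarrow> (V, \<psi>) \<in> atlas N \<Longrightarrow>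
      smooth_on (\<phi> ` (U \<inter> f -` V)) (\<lambda>x. \<psi> (f (inv_into U \<phi> x)))"
  shows "smooth_map M N f"
  using assms unfolding smooth_map_def by (auto simp: o_def)

text \<open>Around each point the representative is the composition of the representatives of \<open>f\<close> and \<open>g\<close>
  through a chart \<open>(V, \<psi>)\<close> of \<open>N\<close>, on the open set of points that \<open>f\<close> sends into \<open>V\<close>.\<close>

lemma smooth_map_compose:
  fixes M :: "('a, 'e::real_normed_vector) manifold"
    and N :: "('b, 'f::real_normed_vector) manifold"
    and P :: "('c, 'g::real_normed_vector) manifold"
  assumes M: "locally_euclidean M" and N: "locally_euclidean N" and P: "locally_euclidean P"
    and f: "smooth_map M N f" and g: "smooth_map N P g"
  shows "smooth_map M P (\<lambda>x. g (f x))"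
proof (rule smooth_mapI)
  show cont: "continuous_map (mtop M) (mtop P) (\<lambda>x. g (f x))"
    using continuous_map_compose[OF smooth_map_continuous[OF f] smooth_map_continuous[OF g]]
    by (simp add: o_def)
  fix U \<phi> W \<omega> assume U: "(U, \<phi>) \<in> atlas M" and W: "(W, \<omega>) \<in> atlas P"
  show "smooth_on (\<phi> ` (U \<inter> (\<lambda>x. g (f x)) -` W)) (\<lambda>x. \<omega> (g (f (inv_into U \<phi> x))))"
  proof (rule smooth_on_local)
    fix x assume "x \<in> \<phi> ` (U \<inter> (\<lambda>x. g (f x)) -` W)"
    then obtain p where p: "p \<in> U" "g (f p) \<in> W" "x = \<phi> p" by blast
    have "f p \<in> topspace (mtop N)"
      using p(1) chart_subset[OF M U] smooth_map_continuous[OF f] unfolding continuous_map_def by blast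
    then obtain V \<psi> where V: "(V, \<psi>) \<in> atlas N" "f p \<in> V" by (rule chart_around[OF N])
    let ?W = "{p \<in> topspace (mtop M). g (f p) \<in> W}"
    let ?V = "{p \<in> topspace (mtop M). f p \<in> V}"
    define T where "T = \<phi> ` (U \<inter> (?V \<inter> ?W))"
    have T: "open T" unfolding T_def
      by (intro chart_image_open[OF M U] openin_Int openin_continuous_map_preimage[OF cont]
          openin_continuous_map_preimage[OF smooth_map_continuous[OF f]] chart_openin[OF P W] chart_openin[OF N V(1)])
    have T_subset: "T \<subseteq> \<phi> ` (U \<inter> f -` V)" unfolding T_def by auto
    have "smooth_on T (\<lambda>x. (\<lambda>y. \<omega> (g (inv_into V \<psi> y))) (\<psi> (f (inv_into U \<phi> x))))"
    proof (rule smooth_on_compose[OF locally_euclidean_finite_dim[OF N] T])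
      show "smooth_on (\<psi> ` (V \<inter> g -` W)) (\<lambda>y. \<omega> (g (inv_into V \<psi> y)))"
        by (rule smooth_map_charts[OF g V(1) W])
      show "smooth_on T (\<lambda>x. \<psi> (f (inv_into U \<phi> x)))"
        by (rule smooth_on_subset[OF smooth_map_charts[OF f U V(1)] T_subset])
      show "(\<lambda>x. \<psi> (f (inv_into U \<phi> x))) ` T \<subseteq> \<psi> ` (V \<inter> g -` W)"
        unfolding T_def using M U by auto
    qed
    then have "smooth_on T (\<lambda>x. \<omega> (g (f (inv_into U \<phi> x))))"
      by (rule smooth_on_cong[OF T, rotated]) (use M U N V in \<open>auto simp: T_def\<close>)
    moreover have "x \<in> T" "T \<subseteq> \<phi> ` (U \<inter> (\<lambda>x. g (f x)) -` W)"
      unfolding T_def using p V chart_subset[OF M U] by auto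
    ultimately show "\<exists>T. open T \<and> x \<in> T \<and> T \<subseteq> \<phi> ` (U \<inter> (\<lambda>x. g (f x)) -` W) \<and>
        smooth_on T (\<lambda>x. \<omega> (g (f (inv_into U \<phi> x))))"
      using T by blast
  qed
qed

lemma smooth_map_id:
  assumes "smooth_manifold M"
  shows "smooth_map M M (\<lambda>x. x)"
proof (rule smooth_mapI)
  show "smooth_on (\<phi> ` (U \<inter> (\<lambda>x. x) -` V)) (\<lambda>x. \<psi> (inv_into U \<phi> x))"
    if "(U, \<phi>) \<in> atlas M" "(V, \<psi>) \<in> atlas M" for U \<phi> V \<psi>
    using assms that unfolding smooth_manifold_def by (fastforce simp: o_def)
qed simp

lemma smooth_map_const:
  assumes "k \<in> topspace (mtop N)"
  shows "smooth_map M N (\<lambda>x. k)"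
  by (rule smooth_mapI) (use assms in \<open>auto simp: smooth_on_const\<close>)

lemma atlas_prod_manifold:
  "c \<in> atlas (prod_manifold M N) \<longleftrightarrow>
    (\<exists>U \<phi> V \<psi>. c = (U \<times> V, map_prod \<phi> \<psi>) \<and> (U, \<phi>) \<in> atlas M \<and> (V, \<psi>) \<in> atlas N)"
  unfolding prod_manifold_def by simp

lemma mtop_prod_manifold: "mtop (prod_manifold M N) = prod_topology (mtop M) (mtop N)"
  unfolding prod_manifold_def by simp

lemma inv_into_map_prod:
  assumes "inj_on \<phi> U" "inj_on \<psi> V" "a \<in> \<phi> ` U" "b \<in> \<psi> ` V"
  shows "inv_into (U \<times> V) (map_prod \<phi> \<psi>) (a, b) = (inv_into U \<phi> a, inv_into V \<psi> b)"
proof -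
  obtain p q where "p \<in> U" "a = \<phi> p" "q \<in> V" "b = \<psi> q" using assms by blast
  then show ?thesis
    using assms inv_into_f_f[OF map_prod_inj_on[OF assms(1,2)], of "(p, q)"] by simp
qed

lemma locally_euclidean_prod:
  fixes M :: "('a, 'e::real_normed_vector) manifold" and N :: "('b, 'f::real_normed_vector) manifold"
  assumes M: "locally_euclidean M" and N: "locally_euclidean N"
  shows "locally_euclidean (prod_manifold M N)"
  unfolding locally_euclidean_def
proof (intro conjI ballI)
  show "finite_dim TYPE('e \<times> 'f)"
    by (intro finite_dim_prod locally_euclidean_finite_dim[OF M] locally_euclidean_finite_dim[OF N])
  have "(\<Union>(U, \<phi>)\<in>atlas (prod_manifold M N). U) =
      (\<Union>(U, \<phi>)\<in>atlas M. U) \<times> (\<Union>(U, \<phi>)\<in>atlas N. U)"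
    unfolding prod_manifold_def by (auto, blast)
  also have "\<dots> = topspace (mtop (prod_manifold M N))"
    using M N unfolding locally_euclidean_def by (simp add: mtop_prod_manifold)
  finally show "(\<Union>(U, \<phi>)\<in>atlas (prod_manifold M N). U) = topspace (mtop (prod_manifold M N))" .
  fix c assume "c \<in> atlas (prod_manifold M N)"
  then obtain U \<phi> V \<psi> where c: "c = (U \<times> V, map_prod \<phi> \<psi>)"
    and U: "(U, \<phi>) \<in> atlas M" and V: "(V, \<psi>) \<in> atlas N"
    by (auto simp: atlas_prod_manifold)
  have im: "map_prod \<phi> \<psi> ` (U \<times> V) = \<phi> ` U \<times> \<psi> ` V" by auto
  have "openin (mtop (prod_manifold M N)) (U \<times> V)"
    by (simp add: mtop_prod_manifold openin_prod_Times_iff chart_openin[OF M U] chart_openin[OF N V])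
  moreover have "open (\<phi> ` U \<times> \<psi> ` V)"
    by (intro open_Times chart_range_open[OF M U] chart_range_open[OF N V])
  moreover have "homeomorphic_map (subtopology (mtop (prod_manifold M N)) (U \<times> V))
      (top_of_set (\<phi> ` U \<times> \<psi> ` V)) (map_prod \<phi> \<psi>)"
  proof -
    obtain \<phi>' \<psi>' where
      1: "homeomorphic_maps (subtopology (mtop M) U) (top_of_set (\<phi> ` U)) \<phi> \<phi>'" and
      2: "homeomorphic_maps (subtopology (mtop N) V) (top_of_set (\<psi> ` V)) \<psi> \<psi>'"
      using chart_homeomorphic[OF M U] chart_homeomorphic[OF N V] by (auto simp: homeomorphic_map_maps)
    have "homeomorphic_maps (prod_topology (subtopology (mtop M) U) (subtopology (mtop N) V))
      (prod_topology (top_of_set (\<phi> ` U)) (top_of_set (\<psi> ` V)))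
      (\<lambda>(x, y). (\<phi> x, \<psi> y)) (\<lambda>(x, y). (\<phi>' x, \<psi>' y))"
      unfolding homeomorphic_maps_prod using 1 2 by blast
    then show ?thesis
      by (auto simp: homeomorphic_map_maps mtop_prod_manifold subtopology_Times map_prod_def)
  qed
  ultimately show "case c of (U, \<phi>) \<Rightarrow> openin (mtop (prod_manifold M N)) U \<and> open (\<phi> ` U) \<and>
      homeomorphic_map (subtopology (mtop (prod_manifold M N)) U) (top_of_set (\<phi> ` U)) \<phi>"
    unfolding c by (simp add: im)
qed

lemma smooth_map_fst:
  assumes M: "smooth_manifold M" and N: "locally_euclidean N"
  shows "smooth_map (prod_manifold M N) M fst"
proof (rule smooth_mapI)
  show "continuous_map (mtop (prod_manifold M N)) (mtop M) fst"
    by (simp add: mtop_prod_manifold continuous_map_fst)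
  note le = smooth_manifold_imp_locally_euclidean[OF M]
  fix c \<kappa> W \<omega> assume c: "(c, \<kappa>) \<in> atlas (prod_manifold M N)" and W: "(W, \<omega>) \<in> atlas M"
  obtain U \<phi> V \<psi> where eq: "c = U \<times> V" "\<kappa> = map_prod \<phi> \<psi>"
    and U: "(U, \<phi>) \<in> atlas M" and V: "(V, \<psi>) \<in> atlas N"
    using c by (auto simp: atlas_prod_manifold)
  \<comment> \<open>The trivial intersection gives both factors the form of an open chart image.\<close>
  have dom: "\<kappa> ` (c \<inter> fst -` W) = \<phi> ` (U \<inter> W) \<times> \<psi> ` (V \<inter> topspace (mtop N))"
    using chart_subset[OF N V] unfolding eq by force
  have op: "open (\<phi> ` (U \<inter> W) \<times> \<psi> ` (V \<inter> topspace (mtop N)))"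
    by (intro open_Times chart_image_open[OF le U] chart_image_open[OF N V] chart_openin[OF le W] openin_topspace)
  have "smooth_on (\<phi> ` (U \<inter> W)) (\<lambda>x. \<omega> (inv_into U \<phi> x))"
    using smooth_map_charts[OF smooth_map_id[OF M] U W] by simp
  then have "smooth_on (\<phi> ` (U \<inter> W) \<times> \<psi> ` (V \<inter> topspace (mtop N))) (\<lambda>z. \<omega> (inv_into U \<phi> (fst z)))"
    by (rule smooth_on_compose[OF locally_euclidean_finite_dim[OF le] op, rotated])
      (auto intro: smooth_on_bounded_linear bounded_linear_fst)
  then show "smooth_on (\<kappa> ` (c \<inter> fst -` W)) (\<lambda>x. \<omega> (fst (inv_into c \<kappa> x)))"
    unfolding dom
    by (rule smooth_on_cong[OF op, rotated])
      (auto simp: eq inv_into_map_prod[OF chart_inj_on[OF le U] chart_inj_on[OF N V]])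
qed

lemma smooth_map_snd:
  assumes M: "locally_euclidean M" and N: "smooth_manifold N"
  shows "smooth_map (prod_manifold M N) N snd"
proof (rule smooth_mapI)
  show "continuous_map (mtop (prod_manifold M N)) (mtop N) snd"
    by (simp add: mtop_prod_manifold continuous_map_snd)
  note le = smooth_manifold_imp_locally_euclidean[OF N]
  fix c \<kappa> W \<omega> assume c: "(c, \<kappa>) \<in> atlas (prod_manifold M N)" and W: "(W, \<omega>) \<in> atlas N"
  obtain U \<phi> V \<psi> where eq: "c = U \<times> V" "\<kappa> = map_prod \<phi> \<psi>"
    and U: "(U, \<phi>) \<in> atlas M" and V: "(V, \<psi>) \<in> atlas N"
    using c by (auto simp: atlas_prod_manifold)
  have dom: "\<kappa> ` (c \<inter> snd -` W) = \<phi> ` (U \<inter> topspace (mtop M)) \<times> \<psi> ` (V \<inter> W)"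
    using chart_subset[OF M U] unfolding eq by force
  have op: "open (\<phi> ` (U \<inter> topspace (mtop M)) \<times> \<psi> ` (V \<inter> W))"
    by (intro open_Times chart_image_open[OF M U] chart_image_open[OF le V] chart_openin[OF le W] openin_topspace)
  have "smooth_on (\<psi> ` (V \<inter> W)) (\<lambda>x. \<omega> (inv_into V \<psi> x))"
    using smooth_map_charts[OF smooth_map_id[OF N] V W] by simp
  then have "smooth_on (\<phi> ` (U \<inter> topspace (mtop M)) \<times> \<psi> ` (V \<inter> W)) (\<lambda>z. \<omega> (inv_into V \<psi> (snd z)))"
    by (rule smooth_on_compose[OF locally_euclidean_finite_dim[OF le] op, rotated])
      (auto intro: smooth_on_bounded_linear bounded_linear_snd)
  then show "smooth_on (\<kappa> ` (c \<inter> snd -` W)) (\<lambda>x. \<omega> (snd (inv_into c \<kappa> x)))"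
    unfolding dom
    by (rule smooth_on_cong[OF op, rotated])
      (auto simp: eq inv_into_map_prod[OF chart_inj_on[OF M U] chart_inj_on[OF le V]])
qed

lemma smooth_map_Pair:
  assumes M: "locally_euclidean M" and N: "locally_euclidean N" and P: "locally_euclidean P"
    and f: "smooth_map M N f" and g: "smooth_map M P g"
  shows "smooth_map M (prod_manifold N P) (\<lambda>x. (f x, g x))"
proof (rule smooth_mapI)
  show cont: "continuous_map (mtop M) (mtop (prod_manifold N P)) (\<lambda>x. (f x, g x))"
    unfolding mtop_prod_manifold
    by (intro continuous_map_pairedI smooth_map_continuous f g)
  fix U \<phi> c \<kappa> assume U: "(U, \<phi>) \<in> atlas M" and c: "(c, \<kappa>) \<in> atlas (prod_manifold N P)"
  obtain V \<psi> W \<omega> where eq: "c = V \<times> W" "\<kappa> = map_prod \<psi> \<omega>"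
    and V: "(V, \<psi>) \<in> atlas N" and W: "(W, \<omega>) \<in> atlas P"
    using c by (auto simp: atlas_prod_manifold)
  let ?D = "\<phi> ` (U \<inter> (\<lambda>x. (f x, g x)) -` c)"
  have op: "open ?D"
    by (rule chart_image_open_vimage[OF M U cont chart_openin[OF locally_euclidean_prod[OF N P] c]])
  have "smooth_on ?D (\<lambda>x. (\<psi> (f (inv_into U \<phi> x)), \<omega> (g (inv_into U \<phi> x))))"
    by (rule smooth_on_Pair[OF op]; rule smooth_on_subset,
        rule smooth_map_charts[OF f U V] smooth_map_charts[OF g U W], auto simp: eq)
  then show "smooth_on ?D (\<lambda>x. \<kappa> (f (inv_into U \<phi> x), g (inv_into U \<phi> x)))"
    by (simp add: eq)
qed


section \<open>Tangent maps in charts\<close>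

text \<open>The coordinate expression of the tangent map of \<open>f\<close> at \<open>p\<close> with respect to the charts \<open>c\<close> and \<open>d\<close>.\<close>

definition chart_derivative ::
    "('a, 'e::real_normed_vector) chart \<Rightarrow> ('b, 'f::real_normed_vector) chart \<Rightarrow> ('a \<Rightarrow> 'b) \<Rightarrow> 'a \<Rightarrow> 'e \<Rightarrow> 'f"
  where
  "chart_derivative c d f p = frechet_derivative (snd d \<circ> f \<circ> inv_into (fst c) (snd c)) (at (snd c p))"

lemma chart_rep_differentiable:
  assumes M: "locally_euclidean M" and N: "locally_euclidean N" and f: "smooth_map M N f"
    and c: "c \<in> atlas M" "p \<in> fst c" and d: "d \<in> atlas N" "f p \<in> fst d"
  shows "(snd d \<circ> f \<circ> inv_into (fst c) (snd c)) differentiable at (snd c p)"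
proof (rule smooth_on_differentiable)
  show "smooth_on (snd c ` (fst c \<inter> f -` fst d)) (snd d \<circ> f \<circ> inv_into (fst c) (snd c))"
    using smooth_map_charts[OF f, of "fst c" "snd c" "fst d" "snd d"] c d by (simp add: o_def)
  show "snd c p \<in> snd c ` (fst c \<inter> f -` fst d)" using c d by blast
qed

lemma chart_derivative_linear:
  assumes "locally_euclidean M" "locally_euclidean N" "smooth_map M N f"
    and "c \<in> atlas M" "p \<in> fst c" "d \<in> atlas N" "f p \<in> fst d"
  shows "linear (chart_derivative c d f p)"
  unfolding chart_derivative_def by (rule linear_frechet_derivative[OF chart_rep_differentiable[OF assms]])

lemma chart_derivative_compose:
  assumes M: "locally_euclidean M" and N: "locally_euclidean N" and P: "locally_euclidean P"
    and f: "smooth_map M N f" and g: "smooth_map N P g"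
    and eq: "\<And>q. q \<in> topspace (mtop M) \<Longrightarrow> h q = g (f q)"
    and c: "c \<in> atlas M" "p \<in> fst c" and d: "d \<in> atlas N" "f p \<in> fst d"
    and e: "e \<in> atlas P" "g (f p) \<in> fst e"
  shows "chart_derivative c e h p v = chart_derivative d e g (f p) (chart_derivative c d f p v)"
proof -
  obtain U \<phi> V \<psi> W \<omega> where [simp]: "c = (U, \<phi>)" "d = (V, \<psi>)" "e = (W, \<omega>)"
    by (metis prod.collapse)
  let ?f = "\<psi> \<circ> f \<circ> inv_into U \<phi>" and ?g = "\<omega> \<circ> g \<circ> inv_into V \<psi>"
  have fp: "?f (\<phi> p) = \<psi> (f p)" using M c by simp
  have f': "(?f has_derivative chart_derivative c d f p) (at (\<phi> p))"
    using chart_rep_differentiable[OF M N f c d]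
    by (simp add: chart_derivative_def frechet_derivative_works[symmetric])
  have g': "(?g has_derivative chart_derivative d e g (f p)) (at (?f (\<phi> p)))"
    unfolding fp using chart_rep_differentiable[OF N P g d e]
    by (simp add: chart_derivative_def frechet_derivative_works[symmetric])
  have "(?g \<circ> ?f has_derivative chart_derivative d e g (f p) \<circ> chart_derivative c d f p) (at (\<phi> p))"
    by (rule diff_chain_at[OF f' g'])
  then have "(\<omega> \<circ> h \<circ> inv_into U \<phi> has_derivative
      chart_derivative d e g (f p) \<circ> chart_derivative c d f p) (at (\<phi> p))"
  proof (rule has_derivative_transform_within_open)
    show "open (\<phi> ` (U \<inter> f -` V))"
      using chart_image_open_vimage[OF M _ smooth_map_continuous[OF f] chart_openin[OF N]] c d by simp
    show "\<phi> p \<in> \<phi> ` (U \<inter> f -` V)" using c d by simp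
    show "(?g \<circ> ?f) x = (\<omega> \<circ> h \<circ> inv_into U \<phi>) x" if "x \<in> \<phi> ` (U \<inter> f -` V)" for x
      using that M N c d chart_subset[OF M, of U \<phi>] eq by auto
  qed
  then have "frechet_derivative (\<omega> \<circ> h \<circ> inv_into U \<phi>) (at (\<phi> p)) =
      chart_derivative d e g (f p) \<circ> chart_derivative c d f p"
    using frechet_derivative_at by metis
  then show ?thesis by (simp add: chart_derivative_def)
qed

lemma chart_derivative_same_chart:
  assumes M: "locally_euclidean M" and c: "c \<in> atlas M" "p \<in> fst c"
    and eq: "\<And>q. q \<in> topspace (mtop M) \<Longrightarrow> f q = q"
  shows "chart_derivative c c f p v = v"
proof -
  obtain U \<phi> where [simp]: "c = (U, \<phi>)" by (metis prod.collapse)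
  have "((\<lambda>x. x) has_derivative (\<lambda>x. x)) (at (\<phi> p))" by (rule has_derivative_ident)
  then have "(\<phi> \<circ> f \<circ> inv_into U \<phi> has_derivative (\<lambda>x. x)) (at (\<phi> p))"
  proof (rule has_derivative_transform_within_open)
    show "open (\<phi> ` U)" using chart_range_open[OF M] c by simp
    show "\<phi> p \<in> \<phi> ` U" using c by simp
    show "x = (\<phi> \<circ> f \<circ> inv_into U \<phi>) x" if "x \<in> \<phi> ` U" for x
      using that M c eq chart_subset[OF M, of U \<phi>] by auto
  qed
  then have "frechet_derivative (\<phi> \<circ> f \<circ> inv_into U \<phi>) (at (\<phi> p)) = (\<lambda>x. x)"
    using frechet_derivative_at by metis
  then show ?thesis by (simp add: chart_derivative_def)
qed

text \<open>The inverse of evaluation at the chart \<open>c\<close>: the tangent vector whose coordinate vector in \<open>c\<close>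
  is \<open>v\<close>.\<close>

definition tangent_vector ::
    "('a, 'e::real_normed_vector) manifold \<Rightarrow> 'a \<Rightarrow> ('a, 'e) chart \<Rightarrow> 'e \<Rightarrow> ('a, 'e) chart \<Rightarrow> 'e" where
  "tangent_vector M p c v = (\<lambda>d. if d \<in> atlas M \<and> p \<in> fst d then chart_derivative c d (\<lambda>x. x) p v else 0)"

lemma tangent_space_iff:
  "t \<in> tangent_space M p \<longleftrightarrow>
    (\<forall>c\<in>atlas M. \<forall>d\<in>atlas M. p \<in> fst c \<and> p \<in> fst d \<longrightarrow> t d = chart_derivative c d (\<lambda>x. x) p (t c)) \<and>
    (\<forall>c. \<not> (c \<in> atlas M \<and> p \<in> fst c) \<longrightarrow> t c = 0)"
  unfolding tangent_space_def chart_derivative_def by (simp add: o_def split_beta)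

text \<open>The compatibility condition is the chain rule for the transitions from \<open>c\<close> to \<open>d\<close> to \<open>e\<close>.\<close>

lemma tangent_vector_in_tangent_space:
  assumes M: "smooth_manifold M" and c: "c \<in> atlas M" "p \<in> fst c"
  shows "tangent_vector M p c v \<in> tangent_space M p"
proof -
  note le = smooth_manifold_imp_locally_euclidean[OF M]
  note id = smooth_map_id[OF M]
  have val: "tangent_vector M p c v d = chart_derivative c d (\<lambda>x. x) p v" if "d \<in> atlas M" "p \<in> fst d" for d
    using that by (simp add: tangent_vector_def)
  have "tangent_vector M p c v e = chart_derivative d e (\<lambda>x. x) p (tangent_vector M p c v d)"
    if d: "d \<in> atlas M" "p \<in> fst d" and e: "e \<in> atlas M" "p \<in> fst e" for d e
    unfolding val[OF d] val[OF e]
    by (rule chart_derivative_compose[OF le le le id id]) (use c d e in auto)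
  moreover have "tangent_vector M p c v d = 0" if "\<not> (d \<in> atlas M \<and> p \<in> fst d)" for d
    unfolding tangent_vector_def using that by (rule if_not_P)
  ultimately show ?thesis unfolding tangent_space_iff by blast
qed

lemma tangent_vector_coordinate:
  assumes M: "smooth_manifold M" and c: "c \<in> atlas M" "p \<in> fst c"
  shows "tangent_vector M p c v c = v"
  using chart_derivative_same_chart[OF smooth_manifold_imp_locally_euclidean[OF M] c, of "\<lambda>x. x"] c
  by (simp add: tangent_vector_def)

lemma tangent_vector_of_coordinate:
  assumes "c \<in> atlas M" "p \<in> fst c" "t \<in> tangent_space M p"
  shows "tangent_vector M p c (t c) = t"
proof
  fix d show "tangent_vector M p c (t c) d = t d"
  proof (cases "d \<in> atlas M \<and> p \<in> fst d")
    case True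
    then have "t d = chart_derivative c d (\<lambda>x. x) p (t c)" using assms unfolding tangent_space_iff by blast
    with True show ?thesis by (simp add: tangent_vector_def)
  next
    case False
    then have "t d = 0" using assms(3) unfolding tangent_space_iff by blast
    then show ?thesis unfolding tangent_vector_def using False by auto
  qed
qed

lemma bij_betw_tangent_vector:
  assumes M: "smooth_manifold M" and c: "c \<in> atlas M" "p \<in> fst c"
  shows "bij_betw (tangent_vector M p c) UNIV (tangent_space M p)"
  by (rule bij_betw_byWitness[of _ "\<lambda>t. t c"])
    (auto simp: tangent_vector_coordinate[OF assms] tangent_vector_of_coordinate[OF c]
      tangent_vector_in_tangent_space[OF assms])

lemma linear_tangent_vector:
  assumes M: "smooth_manifold M" and c: "c \<in> atlas M" "p \<in> fst c"
  shows "linear (tangent_vector M p c)"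
proof -
  note le = smooth_manifold_imp_locally_euclidean[OF M]
  have lin: "linear (chart_derivative c d (\<lambda>x. x) p)" if "d \<in> atlas M" "p \<in> fst d" for d
    by (rule chart_derivative_linear[OF le le smooth_map_id[OF M] c that])
  show ?thesis
    by (rule linearI)
      (simp_all add: tangent_vector_def fun_eq_iff scaleR_fun_def linear_add[OF lin] linear_cmul[OF lin])
qed

definition base_chart :: "('a, 'e) manifold \<Rightarrow> 'a \<Rightarrow> ('a, 'e) chart" where
  "base_chart M p = (SOME c. c \<in> atlas M \<and> p \<in> fst c)"

lemma base_chart:
  assumes "locally_euclidean M" "p \<in> topspace (mtop M)"
  shows "base_chart M p \<in> atlas M" "p \<in> fst (base_chart M p)"
proof -
  obtain U \<phi> where "(U, \<phi>) \<in> atlas M" "p \<in> U" using assms by (rule chart_around)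
  then have "\<exists>c. c \<in> atlas M \<and> p \<in> fst c" by force
  from someI_ex[OF this] show "base_chart M p \<in> atlas M" "p \<in> fst (base_chart M p)"
    unfolding base_chart_def by auto
qed

text \<open>In coordinates the tangent map is the derivative of the representative; the base chart is the one
  that the definition of the tangent map selects in the source, while any chart \<open>d\<close> serves in the
  target. Functoriality and linearity of tangent maps reduce to chart derivatives through this equation.\<close>

lemma tangent_map_tangent_vector:
  assumes M: "smooth_manifold M" and N: "smooth_manifold N" and f: "smooth_map M N f"
    and p: "p \<in> topspace (mtop M)" and d: "d \<in> atlas N" "f p \<in> fst d"
  shows "tangent_map M N f p (tangent_vector M p (base_chart M p) v) =
    tangent_vector N (f p) d (chart_derivative (base_chart M p) d f p v)"
proof -
  let ?c = "base_chart M p"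
  note leM = smooth_manifold_imp_locally_euclidean[OF M] and leN = smooth_manifold_imp_locally_euclidean[OF N]
  note c = base_chart[OF leM p]
  have "tangent_map M N f p (tangent_vector M p ?c v) =
      (\<lambda>e. if e \<in> atlas N \<and> f p \<in> fst e then chart_derivative ?c e f p v else 0)"
    unfolding tangent_map_def base_chart_def[symmetric]
    by (auto simp: Let_def split_beta chart_derivative_def tangent_vector_in_tangent_space[OF M c]
        tangent_vector_coordinate[OF M c])
  also have "\<dots> = tangent_vector N (f p) d (chart_derivative ?c d f p v)"
  proof
    fix e
    have "chart_derivative ?c e f p v = chart_derivative d e (\<lambda>x. x) (f p) (chart_derivative ?c d f p v)"
      if "e \<in> atlas N" "f p \<in> fst e"
      by (rule chart_derivative_compose[OF leM leN leN f smooth_map_id[OF N]]) (use c d that in auto)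
    then show "(if e \<in> atlas N \<and> f p \<in> fst e then chart_derivative ?c e f p v else 0) =
        tangent_vector N (f p) d (chart_derivative ?c d f p v) e"
      by (simp add: tangent_vector_def)
  qed
  finally show ?thesis .
qed

lemma tangent_map_extensional: "tangent_map M N f p \<in> extensional (tangent_space M p)"
  unfolding tangent_map_def by (simp add: split_beta)

lemma tangent_space_cases:
  assumes M: "smooth_manifold M" and p: "p \<in> topspace (mtop M)" and t: "t \<in> tangent_space M p"
  obtains v where "t = tangent_vector M p (base_chart M p) v"
  using tangent_vector_of_coordinate[OF base_chart[OF smooth_manifold_imp_locally_euclidean[OF M] p] t]
  by metis

lemma tangent_map_compose:
  assumes M: "smooth_manifold M" and p: "p \<in> topspace (mtop M)"
    and f: "smooth_map M M f" "f p = p" and g: "smooth_map M M g" "g p = p"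
    and h: "smooth_map M M h"
    and eq: "\<And>q. q \<in> topspace (mtop M) \<Longrightarrow> h q = g (f q)"
  shows "tangent_map M M h p = compose (tangent_space M p) (tangent_map M M g p) (tangent_map M M f p)"
proof (rule extensionalityI[OF tangent_map_extensional compose_extensional])
  note le = smooth_manifold_imp_locally_euclidean[OF M]
  note c = base_chart[OF le p]
  have hp: "h p = p" using eq[OF p] f g by simp
  fix t assume t: "t \<in> tangent_space M p"
  then obtain v where v: "t = tangent_vector M p (base_chart M p) v"
    using tangent_space_cases[OF M p] by blast
  let ?c = "base_chart M p"
  have "chart_derivative ?c ?c h p v = chart_derivative ?c ?c g (f p) (chart_derivative ?c ?c f p v)"
    by (rule chart_derivative_compose[OF le le le f(1) g(1)]) (use c f g eq in auto)
  then show "tangent_map M M h p t = compose (tangent_space M p) (tangent_map M M g p) (tangent_map M M f p) t"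
    using t f g c hp tangent_map_tangent_vector[OF M M f(1) p, of ?c]
      tangent_map_tangent_vector[OF M M g(1) p, of ?c] tangent_map_tangent_vector[OF M M h p, of ?c]
    by (simp add: v compose_eq)
qed

lemma tangent_map_identity:
  assumes M: "smooth_manifold M" and p: "p \<in> topspace (mtop M)"
    and f: "smooth_map M M f"
    and eq: "\<And>q. q \<in> topspace (mtop M) \<Longrightarrow> f q = q"
    and t: "t \<in> tangent_space M p"
  shows "tangent_map M M f p t = t"
proof -
  note le = smooth_manifold_imp_locally_euclidean[OF M]
  note c = base_chart[OF le p]
  obtain v where v: "t = tangent_vector M p (base_chart M p) v"
    using tangent_space_cases[OF M p t] by blast
  show ?thesis
    using tangent_map_tangent_vector[OF M M f p, of "base_chart M p" v] c eq[OF p]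
      chart_derivative_same_chart[OF le c eq, of v] by (simp add: v)
qed

lemma tangent_map_closed:
  assumes M: "smooth_manifold M" and p: "p \<in> topspace (mtop M)"
    and f: "smooth_map M M f" "f p = p" and t: "t \<in> tangent_space M p"
  shows "tangent_map M M f p t \<in> tangent_space M p"
proof -
  note c = base_chart[OF smooth_manifold_imp_locally_euclidean[OF M] p]
  obtain v where v: "t = tangent_vector M p (base_chart M p) v"
    using tangent_space_cases[OF M p t] by blast
  show ?thesis
    using tangent_map_tangent_vector[OF M M f(1) p, of "base_chart M p" v] c f(2)
    by (simp add: v tangent_vector_in_tangent_space[OF M c])
qed

text \<open>By functoriality the tangent map of the inverse map is an inverse of the tangent map.\<close>

lemma tangent_map_in_linear_autos:
  assumes M: "smooth_manifold M" and p: "p \<in> topspace (mtop M)"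
    and f: "smooth_map M M f" "f p = p" and g: "smooth_map M M g" "g p = p"
    and gf: "\<And>q. q \<in> topspace (mtop M) \<Longrightarrow> g (f q) = q"
    and fg: "\<And>q. q \<in> topspace (mtop M) \<Longrightarrow> f (g q) = q"
  shows "tangent_map M M f p \<in> linear_autos (tangent_space M p)"
proof -
  let ?V = "tangent_space M p" and ?c = "base_chart M p"
  let ?e = "tangent_vector M p ?c"
  note le = smooth_manifold_imp_locally_euclidean[OF M]
  note c = base_chart[OF le p]
  have inverse: "tangent_map M M k p (tangent_map M M h p t) = t"
    if hk: "smooth_map M M h" "h p = p" "smooth_map M M k" "k p = p"
      and eq: "\<And>q. q \<in> topspace (mtop M) \<Longrightarrow> k (h q) = q" and t: "t \<in> ?V" for h k t
  proof -
    have kh: "smooth_map M M (\<lambda>x. k (h x))" using smooth_map_compose[OF le le le] hk by blast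
    show ?thesis
      using fun_cong[OF tangent_map_compose[OF M p hk kh], of t] tangent_map_identity[OF M p kh eq t] t
      by (simp add: compose_eq)
  qed
  have "bij_betw (tangent_map M M f p) ?V ?V"
    by (rule bij_betw_byWitness[of _ "tangent_map M M g p"])
      (use inverse[OF f g gf] inverse[OF g f fg] tangent_map_closed[OF M p f] tangent_map_closed[OF M p g] in auto)
  moreover have T: "tangent_map M M f p (?e v) = ?e (chart_derivative ?c ?c f p v)" for v
    using tangent_map_tangent_vector[OF M M f(1) p, of ?c v] c f(2) by simp
  have linA: "linear (chart_derivative ?c ?c f p)"
    using chart_derivative_linear[OF le le f(1) c, of ?c] c f(2) by simp
  have line: "linear ?e" by (rule linear_tangent_vector[OF M c])
  have "tangent_map M M f p (x + y) = tangent_map M M f p x + tangent_map M M f p y"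
    if xy: "x \<in> ?V" "y \<in> ?V" for x y
  proof -
    obtain v w where "x = ?e v" "y = ?e w" using xy tangent_space_cases[OF M p] by metis
    then show ?thesis by (simp add: T linear_add[OF linA] linear_add[OF line] flip: linear_add[OF line])
  qed
  moreover have "tangent_map M M f p (r *\<^sub>R x) = r *\<^sub>R tangent_map M M f p x" if x: "x \<in> ?V" for r x
  proof -
    obtain v where "x = ?e v" using x tangent_space_cases[OF M p] by metis
    then show ?thesis by (simp add: T linear_cmul[OF linA] flip: linear_cmul[OF line])
  qed
  ultimately show ?thesis
    unfolding linear_autos_def Bij_def by (auto simp: tangent_map_extensional)
qed

text \<open>The derivative of \<open>F(m, \<cdot>)\<close> at \<open>p\<close> is the total derivative of a representative of \<open>F\<close> at
  \<open>(m, p)\<close> applied to the vertical direction \<open>(0, w)\<close>. Directional derivatives of smooth maps are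
  smooth, so this depends smoothly on \<open>m\<close>.\<close>

lemma smooth_on_parameter_derivative:
  fixes M :: "('a, 'm::real_normed_vector) manifold" and N :: "('b, 'e::real_normed_vector) manifold"
    and P :: "('c, 'f::real_normed_vector) manifold"
  assumes M: "locally_euclidean M" and N: "locally_euclidean N" and P: "locally_euclidean P"
    and F: "smooth_map (prod_manifold M N) P (\<lambda>(m, n). F m n)"
    and c: "c \<in> atlas N" "p \<in> fst c"
    and d: "d \<in> atlas P" "\<And>m. m \<in> topspace (mtop M) \<Longrightarrow> F m p \<in> fst d"
    and U: "(U, \<phi>) \<in> atlas M"
  shows "smooth_on (\<phi> ` U) (\<lambda>x. chart_derivative c d (F (inv_into U \<phi> x)) p w)"
proof -
  obtain V \<psi> W \<omega> where cd [simp]: "c = (V, \<psi>)" "d = (W, \<omega>)" by (metis prod.collapse)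
  have V: "(V, \<psi>) \<in> atlas N" "p \<in> V" and W: "(W, \<omega>) \<in> atlas P" using c d by auto
  let ?y = "\<psi> p"
  define f where "f = (\<lambda>z. \<omega> (F (inv_into U \<phi> (fst z)) (inv_into V \<psi> (snd z))))"
  define D where "D = map_prod \<phi> \<psi> ` ((U \<times> V) \<inter> (\<lambda>(m, n). F m n) -` W)"
  have prod: "locally_euclidean (prod_manifold M N)" by (rule locally_euclidean_prod[OF M N])
  have UV: "(U \<times> V, map_prod \<phi> \<psi>) \<in> atlas (prod_manifold M N)"
    using U V by (auto simp: atlas_prod_manifold)
  have D: "open D" unfolding D_def
    by (rule chart_image_open_vimage[OF prod UV smooth_map_continuous[OF F] chart_openin[OF P W]])
  have f: "smooth_on D f"
    unfolding D_def
    by (rule smooth_on_cong[OF D[unfolded D_def] _ smooth_map_charts[OF F UV W]])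
      (auto simp: f_def inv_into_map_prod[OF chart_inj_on[OF M U] chart_inj_on[OF N V(1)]] M U N V)
  have in_D: "(x, ?y) \<in> D" if x: "x \<in> \<phi> ` U" for x
  proof -
    obtain m where m: "m \<in> U" "x = \<phi> m" using x by blast
    then have "(m, p) \<in> (U \<times> V) \<inter> (\<lambda>(m, n). F m n) -` W"
      using V(2) d(2)[of m] chart_subset[OF M U] by auto
    then show ?thesis unfolding D_def m(2) by (metis image_eqI map_prod_simp)
  qed
  have opU: "open (\<phi> ` U)" by (rule chart_range_open[OF M U])
  \<comment> \<open>The chain rule along the vertical line through \<open>x\<close>.\<close>
  have "chart_derivative c d (F (inv_into U \<phi> x)) p w = frechet_derivative f (at (x, ?y)) (0, w)"
    if x: "x \<in> \<phi> ` U" for x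
  proof -
    have "(f has_derivative frechet_derivative f (at (x, ?y))) (at (x, ?y))"
      using smooth_on_differentiable[OF f in_D[OF x]] by (simp add: frechet_derivative_works)
    moreover have "((\<lambda>y. (x, y)) has_derivative (\<lambda>v. (0, v))) (at ?y)"
      by (intro has_derivative_Pair has_derivative_const has_derivative_ident)
    ultimately have "((\<lambda>y. f (x, y)) has_derivative (\<lambda>v. frechet_derivative f (at (x, ?y)) (0, v))) (at ?y)"
      using has_derivative_compose by blast
    then have "(\<omega> \<circ> F (inv_into U \<phi> x) \<circ> inv_into V \<psi> has_derivative
        (\<lambda>v. frechet_derivative f (at (x, ?y)) (0, v))) (at ?y)"
      by (simp add: f_def o_def)
    then show ?thesis
      using frechet_derivative_at unfolding chart_derivative_def cd fst_conv snd_conv by metis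
  qed
  moreover have "smooth_on (\<phi> ` U) (\<lambda>x. frechet_derivative f (at (x, ?y)) (0, w))"
  proof (rule smooth_on_compose[OF locally_euclidean_finite_dim[OF prod] opU,
        where f = "\<lambda>x. (x, ?y)" and g = "\<lambda>z. frechet_derivative f (at z) (0, w)"])
    show "smooth_on D (\<lambda>z. frechet_derivative f (at z) (0, w))"
      by (rule smooth_on_frechet_derivative[OF f])
    show "smooth_on (\<phi> ` U) (\<lambda>x. (x, ?y))"
      by (intro smooth_on_Pair opU smooth_on_const smooth_on_bounded_linear bounded_linear_ident)
    show "(\<lambda>x. (x, ?y)) ` \<phi> ` U \<subseteq> D" using in_D by blast
  qed
  ultimately show ?thesis
    using smooth_on_cong[OF opU, of "\<lambda>x. frechet_derivative f (at (x, ?y)) (0, w)"] by simp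
qed


section \<open>Smooth maps into the general linear group\<close>

text \<open>Continuity into the general linear group is part of the definition of a smooth map, and its
  topology is generated by preimages under the charts; so it too is obtained from representatives.\<close>

lemma continuous_map_from_charts:
  assumes M: "locally_euclidean M"
    and cont: "\<And>U \<phi>. (U, \<phi>) \<in> atlas M \<Longrightarrow> continuous_on (\<phi> ` U) (\<lambda>x. F (inv_into U \<phi> x))"
  shows "continuous_map (mtop M) euclidean F"
proof -
  have "openin (mtop M) {p \<in> topspace (mtop M). F p \<in> W}" if W: "open W" for W
  proof (subst openin_subopen, intro ballI)
    fix p assume "p \<in> {p \<in> topspace (mtop M). F p \<in> W}"
    then have p: "p \<in> topspace (mtop M)" "F p \<in> W" by auto
    obtain U \<phi> where U: "(U, \<phi>) \<in> atlas M" "p \<in> U" by (rule chart_around[OF M p(1)])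
    let ?O = "\<phi> ` U \<inter> (\<lambda>x. F (inv_into U \<phi> x)) -` W"
    have "openin (top_of_set (\<phi> ` U)) ?O"
      by (rule continuous_openin_preimage_gen[OF cont[OF U(1)] W])
    then have "openin (subtopology (mtop M) U) {q \<in> topspace (subtopology (mtop M) U). \<phi> q \<in> ?O}"
      by (rule openin_continuous_map_preimage[OF homeomorphic_imp_continuous_map[OF chart_homeomorphic[OF M U(1)]]])
    then have "openin (mtop M) {q \<in> topspace (subtopology (mtop M) U). \<phi> q \<in> ?O}"
      using openin_trans_full chart_openin[OF M U(1)] by blast
    moreover have "{q \<in> topspace (subtopology (mtop M) U). \<phi> q \<in> ?O} = {q \<in> U. F q \<in> W}"
      using chart_subset[OF M U(1)] M U(1) by (auto dest: inj_onD[OF chart_inj_on[OF M U(1)]])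
    ultimately show "\<exists>T. openin (mtop M) T \<and> p \<in> T \<and> T \<subseteq> {p \<in> topspace (mtop M). F p \<in> W}"
      using p U(2) chart_subset[OF M U(1)] by (intro exI[of _ "{q \<in> U. F q \<in> W}"]) auto
  qed
  then show ?thesis by (simp add: continuous_map_def)
qed

lemma linear_change_of_basis:
  assumes b: "linear b" "bij_betw b UNIV V" and e: "linear e" "bij_betw e UNIV V"
  shows "linear (\<lambda>v. inv_into UNIV b (e v))"
proof (rule linearI)
  have inj: "inj b" using b(2) by (simp add: bij_betw_def)
  have binv: "b (inv_into UNIV b (e v)) = e v" for v
    using b(2) e(2) by (metis bij_betw_def f_inv_into_f rangeI)
  show "inv_into UNIV b (e (v + w)) = inv_into UNIV b (e v) + inv_into UNIV b (e w)" for v w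
    by (rule injD[OF inj]) (simp only: linear_add[OF b(1)] binv, rule linear_add[OF e(1)])
  show "inv_into UNIV b (e (r *\<^sub>R v)) = r *\<^sub>R inv_into UNIV b (e v)" for r v
    by (rule injD[OF inj]) (simp only: linear_cmul[OF b(1)] binv, rule linear_cmul[OF e(1)])
qed

text \<open>The atlas of \<open>GL(V)\<close> has a chart for every linear isomorphism \<open>b\<close> onto \<open>V\<close>, whereas \<open>T\<close> is known
  through its matrices \<open>A\<close> with respect to one isomorphism \<open>e\<close>. In the chart of \<open>b\<close> the operator \<open>T p\<close>
  becomes the conjugate of \<open>A p\<close> by the change of basis \<open>b\<^sup>-\<^sup>1 e\<close>, which is constant in \<open>p\<close>; so the
  smoothness of all \<open>A(p) v\<close> suffices.\<close>

lemma smooth_map_into_GL: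
  fixes M :: "('a, 'm::real_normed_vector) manifold" and e :: "'e::real_normed_vector \<Rightarrow> 'v::real_vector"
  assumes M: "locally_euclidean M" and fd: "finite_dim TYPE('e)"
    and e: "linear e" "bij_betw e UNIV V"
    and T: "\<And>p. p \<in> topspace (mtop M) \<Longrightarrow> T p \<in> linear_autos V"
    and TA: "\<And>p v. p \<in> topspace (mtop M) \<Longrightarrow> T p (e v) = e (A p v)"
    and A: "\<And>p. p \<in> topspace (mtop M) \<Longrightarrow> linear (A p)"
    and smooth: "\<And>U \<phi> v. (U, \<phi>) \<in> atlas M \<Longrightarrow> smooth_on (\<phi> ` U) (\<lambda>x. A (inv_into U \<phi> x) v)"
  shows "smooth_map M (mfd (GL TYPE('e) V)) T"
proof -
  let ?coord = "\<lambda>b :: 'e \<Rightarrow> 'v. \<lambda>S. Blinfun (inv_into UNIV b \<circ> S \<circ> b)"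
  have local_smooth: "smooth_on (\<phi> ` U) (\<lambda>x. ?coord b (T (inv_into U \<phi> x)))"
    if U: "(U, \<phi>) \<in> atlas M" and b: "linear b" "bij_betw b UNIV V" for U \<phi> b
  proof -
    \<comment> \<open>The change of basis and its inverse.\<close>
    define k where "k v = inv_into UNIV b (e v)" for v
    define k' where "k' v = inv_into UNIV e (b v)" for v
    have k: "linear k" and k': "linear k'"
      unfolding k_def k'_def using linear_change_of_basis b e by blast+
    have ek': "e (k' v) = b v" for v
      unfolding k'_def using b(2) e(2) by (metis bij_betw_def f_inv_into_f rangeI)
    have eq: "inv_into UNIV b \<circ> T p \<circ> b = (\<lambda>v. k (A p (k' v)))" if p: "p \<in> topspace (mtop M)" for p
      using TA[OF p] by (auto simp: fun_eq_iff k_def simp flip: ek')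
    have op: "open (\<phi> ` U)" by (rule chart_range_open[OF M U])
    have in_M: "inv_into U \<phi> x \<in> topspace (mtop M)" if "x \<in> \<phi> ` U" for x
      using that chart_subset[OF M U] inv_into_into by (metis subsetD)
    have "smooth_on (\<phi> ` U) (\<lambda>x. Blinfun (\<lambda>v. k (A (inv_into U \<phi> x) (k' v))))"
    proof (rule smooth_on_Blinfun[OF fd op])
      show "linear (\<lambda>v. k (A (inv_into U \<phi> x) (k' v)))" if "x \<in> \<phi> ` U" for x
        using linear_compose[OF linear_compose[OF k' A[OF in_M[OF that]]] k] by (simp add: o_def)
      show "smooth_on (\<phi> ` U) (\<lambda>x. k (A (inv_into U \<phi> x) (k' v)))" for v
        by (rule smooth_on_bounded_linear_comp[OF op linear_finite_dim_bounded[OF fd k] smooth[OF U]])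
    qed
    then show ?thesis
      by (rule smooth_on_cong[OF op, rotated]) (simp add: eq in_M)
  qed
  show ?thesis
  proof (rule smooth_mapI)
    show "continuous_map (mtop M) (mtop (mfd (GL TYPE('e) V))) T"
      unfolding GL_def manifold.select_convs lie_grp.select_convs
    proof (rule continuous_on_generated_topo)
      fix O' assume "O' \<in> {U \<inter> \<phi> -` W |U \<phi> (W :: ('e \<Rightarrow>\<^sub>L 'e) set). (U, \<phi>) \<in> GL_atlas V \<and> open W}"
      then obtain b and W :: "('e \<Rightarrow>\<^sub>L 'e) set" where b: "linear b" "bij_betw b UNIV V" and W: "open W"
        and O': "O' = linear_autos V \<inter> ?coord b -` W"
        unfolding GL_atlas_def GL_chart_def by blast
      have "continuous_map (mtop M) euclidean (\<lambda>p. ?coord b (T p))"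
        by (rule continuous_map_from_charts[OF M smooth_on_imp_continuous_on[OF local_smooth[OF _ b]]])
      then have "openin (mtop M) {p \<in> topspace (mtop M). ?coord b (T p) \<in> W}"
        using W by (simp add: openin_continuous_map_preimage)
      moreover have "T -` O' \<inter> topspace (mtop M) = {p \<in> topspace (mtop M). ?coord b (T p) \<in> W}"
        using T unfolding O' by auto
      ultimately show "openin (mtop M) (T -` O' \<inter> topspace (mtop M))" by simp
    next
      \<comment> \<open>The isomorphism \<open>e\<close> provides a chart, so the generating sets cover the group.\<close>
      have "linear_autos V \<inter> ?coord e -` UNIV \<in>
          {U \<inter> \<phi> -` W |U \<phi> (W :: ('e \<Rightarrow>\<^sub>L 'e) set). (U, \<phi>) \<in> GL_atlas V \<and> open W}"
        unfolding GL_atlas_def GL_chart_def using e open_UNIV by blast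
      then show "T ` topspace (mtop M) \<subseteq>
          \<Union> {U \<inter> \<phi> -` W |U \<phi> (W :: ('e \<Rightarrow>\<^sub>L 'e) set). (U, \<phi>) \<in> GL_atlas V \<and> open W}"
        using T by blast
    qed
  next
    fix U \<phi> L \<kappa> assume U: "(U, \<phi>) \<in> atlas M" and "(L, \<kappa>) \<in> atlas (mfd (GL TYPE('e) V))"
    then obtain b where b: "linear b" "bij_betw b UNIV V" and L: "L = linear_autos V" "\<kappa> = ?coord b"
      unfolding GL_def GL_atlas_def GL_chart_def by auto
    have "U \<inter> T -` L = U" using T chart_subset[OF M U] unfolding L by auto
    then show "smooth_on (\<phi> ` (U \<inter> T -` L)) (\<lambda>x. \<kappa> (T (inv_into U \<phi> x)))"
      using local_smooth[OF U b] by (simp add: L)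
  qed
qed


section \<open>The right action of the descendent group\<close>

locale rota_baxter = G: lie_group G + H: lie_group H
  for G :: "('g, 'e::real_normed_vector) lie_grp"
    and H :: "('h, 'f::real_normed_vector) lie_grp" +
  fixes \<Phi> :: "'g \<Rightarrow> 'h \<Rightarrow> 'h" and B :: "'h \<Rightarrow> 'g"
  assumes action: "lie_group_action G H \<Phi>"
    and rota_baxter: "relative_rota_baxter G H \<Phi> B"
begin

abbreviation mult_G (infixl "\<cdot>" 70) where "x \<cdot> y \<equiv> x \<otimes>\<^bsub>G\<^esub> y"
abbreviation mult_H (infixl "\<bullet>\<^sub>H" 70) where "x \<bullet>\<^sub>H y \<equiv> x \<otimes>\<^bsub>H\<^esub> y"
abbreviation star (infixl "\<star>" 70) where "h \<star> k \<equiv> h \<bullet>\<^sub>H \<Phi> (B h) k"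
abbreviation dag ("_\<^sup>\<dagger>" [1000] 999) where "h\<^sup>\<dagger> \<equiv> dagger G H \<Phi> B h"

lemma Phi_in_auto: "g \<in> carrier G \<Longrightarrow> \<Phi> g \<in> hom H H \<and> \<Phi> g \<in> Bij (carrier H)"
  using action unfolding lie_group_action_def LieAut_def hom_def auto_def by auto

lemma Phi_closed [simp]: "g \<in> carrier G \<Longrightarrow> h \<in> carrier H \<Longrightarrow> \<Phi> g h \<in> carrier H"
  using Phi_in_auto hom_in_carrier by metis

lemma Phi_mult_H: "g \<in> carrier G \<Longrightarrow> h \<in> carrier H \<Longrightarrow> k \<in> carrier H \<Longrightarrow> \<Phi> g (h \<bullet>\<^sub>H k) = \<Phi> g h \<bullet>\<^sub>H \<Phi> g k"
  using Phi_in_auto hom_mult by metis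

lemma Phi_one_H [simp]: "g \<in> carrier G \<Longrightarrow> \<Phi> g \<one>\<^bsub>H\<^esub> = \<one>\<^bsub>H\<^esub>"
  using hom_one[of "\<Phi> g" H H] Phi_in_auto H.group_axioms by blast

lemma Phi_inv_H:
  assumes "g \<in> carrier G" "h \<in> carrier H"
  shows "\<Phi> g (inv\<^bsub>H\<^esub> h) = inv\<^bsub>H\<^esub> (\<Phi> g h)"
proof -
  interpret group_hom H H "\<Phi> g"
    using Phi_in_auto[OF assms(1)] by unfold_locales blast
  show ?thesis using assms(2) by simp
qed

lemma Phi_mult_G:
  assumes "g \<in> carrier G" "g' \<in> carrier G" "h \<in> carrier H"
  shows "\<Phi> (g \<cdot> g') h = \<Phi> g (\<Phi> g' h)"
proof -
  have "\<Phi> (g \<cdot> g') = \<Phi> g \<otimes>\<^bsub>LieAut H\<^esub> \<Phi> g'"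
    using action assms unfolding lie_group_action_def by (simp add: hom_mult)
  also have "\<dots> = compose (carrier H) (\<Phi> g) (\<Phi> g')"
    using Phi_in_auto assms by (simp add: LieAut_def AutoGroup_def BijGroup_def)
  finally show ?thesis using assms(3) by (simp add: compose_eq)
qed

text \<open>The map \<open>\<Phi>(1)\<close> is idempotent and injective.\<close>

lemma Phi_one_G [simp]:
  assumes h: "h \<in> carrier H"
  shows "\<Phi> \<one>\<^bsub>G\<^esub> h = h"
proof -
  have "inj_on (\<Phi> \<one>\<^bsub>G\<^esub>) (carrier H)"
    using Phi_in_auto[of "\<one>\<^bsub>G\<^esub>"] by (simp add: Bij_def bij_betw_def)
  moreover have "\<Phi> \<one>\<^bsub>G\<^esub> (\<Phi> \<one>\<^bsub>G\<^esub> h) = \<Phi> \<one>\<^bsub>G\<^esub> h"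
    using Phi_mult_G[of "\<one>\<^bsub>G\<^esub>" "\<one>\<^bsub>G\<^esub>" h] h by simp
  ultimately show ?thesis using h by (simp add: inj_on_eq_iff)
qed

lemma smooth_B: "smooth_map (mfd H) (mfd G) B"
  using rota_baxter unfolding relative_rota_baxter_def by blast

lemma B_closed [simp]: "h \<in> carrier H \<Longrightarrow> B h \<in> carrier G"
  using smooth_map_continuous[OF smooth_B] G.topspace_eq_carrier H.topspace_eq_carrier
  unfolding continuous_map_def by blast

lemma B_mult: "h \<in> carrier H \<Longrightarrow> k \<in> carrier H \<Longrightarrow> B (h \<star> k) = B h \<cdot> B k"
  using rota_baxter unfolding relative_rota_baxter_def by simp

lemma B_one [simp]: "B \<one>\<^bsub>H\<^esub> = \<one>\<^bsub>G\<^esub>"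
proof -
  have "B \<one>\<^bsub>H\<^esub> \<cdot> B \<one>\<^bsub>H\<^esub> = B \<one>\<^bsub>H\<^esub>"
    using B_mult[of "\<one>\<^bsub>H\<^esub>" "\<one>\<^bsub>H\<^esub>"] by simp
  then show ?thesis by (simp add: G.l_cancel_one)
qed

lemma dagger_closed [simp]: "h \<in> carrier H \<Longrightarrow> h\<^sup>\<dagger> \<in> carrier H"
  by (simp add: dagger_def)

lemma dagger_one: "\<one>\<^bsub>H\<^esub>\<^sup>\<dagger> = \<one>\<^bsub>H\<^esub>"
  by (simp add: dagger_def)

lemma star_dagger: 
  assumes h: "h \<in> carrier H"
  shows "h \<star> h\<^sup>\<dagger> = \<one>\<^bsub>H\<^esub>"
  using h by (simp add: dagger_def flip: Phi_mult_G)

lemma B_dagger: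
  assumes h: "h \<in> carrier H"
  shows "B (h\<^sup>\<dagger>) = inv\<^bsub>G\<^esub> (B h)"
proof -
  have "B h \<cdot> B (h\<^sup>\<dagger>) = \<one>\<^bsub>G\<^esub>" using B_mult[of h "h\<^sup>\<dagger>"] star_dagger[OF h] h by simp
  then show ?thesis using h by (metis B_closed G.inv_equality G.inv_inv dagger_closed)
qed

lemma dagger_star_self:
  assumes h: "h \<in> carrier H"
  shows "h\<^sup>\<dagger> \<star> h = \<one>\<^bsub>H\<^esub>"
  using h unfolding B_dagger[OF h] by (simp add: dagger_def Phi_inv_H)

text \<open>Inversion reverses products. With \<open>B(h \<star> k) = B(h) B(k)\<close> this comes out of the formula for
  \<open>\<dagger>\<close> and the homomorphism laws of \<open>\<Phi>\<close>.\<close>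

lemma dagger_star:
  assumes h: "h \<in> carrier H" and k: "k \<in> carrier H"
  shows "(h \<star> k)\<^sup>\<dagger> = k\<^sup>\<dagger> \<star> h\<^sup>\<dagger>"
proof -
  have "(h \<star> k)\<^sup>\<dagger> = \<Phi> (inv\<^bsub>G\<^esub> (B k)) (\<Phi> (inv\<^bsub>G\<^esub> (B h)) (\<Phi> (B h) (inv\<^bsub>H\<^esub> k) \<bullet>\<^sub>H inv\<^bsub>H\<^esub> h))"
    using h k by (simp add: dagger_def B_mult G.inv_mult_group H.inv_mult_group Phi_mult_G Phi_inv_H)
  also have "\<dots> = k\<^sup>\<dagger> \<bullet>\<^sub>H \<Phi> (inv\<^bsub>G\<^esub> (B k)) (h\<^sup>\<dagger>)"
    using h k by (simp add: dagger_def Phi_mult_H flip: Phi_mult_G[of "inv\<^bsub>G\<^esub> (B h)" "B h"])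
  finally show ?thesis using B_dagger[OF k] by simp
qed

text \<open>The component in \<open>G\<close> of the product \<open>(1, g) (k, B k)\<close>, computed in the semidirect product of \<open>H\<close>
  and \<open>G\<close> and written as an element of the graph of \<open>B\<close> times an element of \<open>G\<close>: it equals
  \<open>(\<Phi>(g) k, B(\<Phi>(g) k)) (1, g \<triangleleft> k)\<close>.\<close>

definition act :: "'g \<Rightarrow> 'h \<Rightarrow> 'g" (infixl "\<triangleleft>" 70) where
  "g \<triangleleft> k = inv\<^bsub>G\<^esub> (B (\<Phi> g k)) \<cdot> g \<cdot> B k"

lemma act_closed [simp]: "g \<in> carrier G \<Longrightarrow> k \<in> carrier H \<Longrightarrow> g \<triangleleft> k \<in> carrier G"
  by (simp add: act_def)

text \<open>So \<open>\<Theta>\<close> is the left action obtained from a right action by composing with inversion.\<close>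

lemma Theta_eq_act: "Theta G H \<Phi> B h g = g \<triangleleft> h\<^sup>\<dagger>"
  by (simp add: Theta_def act_def)

lemma act_one: "g \<in> carrier G \<Longrightarrow> g \<triangleleft> \<one>\<^bsub>H\<^esub> = g"
  by (simp add: act_def)

lemma one_act: "k \<in> carrier H \<Longrightarrow> \<one>\<^bsub>G\<^esub> \<triangleleft> k = \<one>\<^bsub>G\<^esub>"
  by (simp add: act_def)

text \<open>With \<open>a = B(\<Phi>(g) k)\<close> the definition says \<open>a (g \<triangleleft> k) = g B(k)\<close>. This identity moves \<open>g\<close> past
  \<open>k\<close> and yields \<open>\<Phi>(g)(k \<star> l) = \<Phi>(g) k \<star> \<Phi>(g \<triangleleft> k) l\<close>. Applying \<open>B\<close>, which turns \<open>\<star>\<close> into the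
  product of \<open>G\<close>, the correction factor of \<open>k \<star> l\<close> splits into those of the two steps.\<close>

lemma act_star:
  assumes g: "g \<in> carrier G" and k: "k \<in> carrier H" and l: "l \<in> carrier H"
  shows "g \<triangleleft> (k \<star> l) = (g \<triangleleft> k) \<triangleleft> l"
proof -
  let ?a = "B (\<Phi> g k)" and ?g = "g \<triangleleft> k"
  have a: "?a \<in> carrier G" using g k by simp
  have ag: "?a \<cdot> ?g = g \<cdot> B k" using g k by (simp add: act_def G.m_assoc flip: G.m_assoc[of ?a])
  \<comment> \<open>Moving \<open>g\<close> past \<open>k\<close>.\<close>
  have "\<Phi> g (k \<star> l) = \<Phi> g k \<bullet>\<^sub>H \<Phi> (g \<cdot> B k) l"
    using g k l by (simp add: Phi_mult_H Phi_mult_G)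
  also have "\<dots> = \<Phi> g k \<star> \<Phi> ?g l"
    using g k l a by (simp add: Phi_mult_G flip: ag)
  finally have "B (\<Phi> g (k \<star> l)) = ?a \<cdot> B (\<Phi> ?g l)"
    using g k l by (simp add: B_mult)
  then have "g \<triangleleft> (k \<star> l) = inv\<^bsub>G\<^esub> (?a \<cdot> B (\<Phi> ?g l)) \<cdot> g \<cdot> (B k \<cdot> B l)"
    using k l by (simp add: act_def[of g "k \<star> l"] B_mult)
  also have "\<dots> = inv\<^bsub>G\<^esub> (B (\<Phi> ?g l)) \<cdot> (inv\<^bsub>G\<^esub> ?a \<cdot> g \<cdot> B k) \<cdot> B l"
    using g k l a by (simp add: G.inv_mult_group G.m_assoc)
  also have "\<dots> = ?g \<triangleleft> l" by (simp add: act_def)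
  finally show ?thesis .
qed

lemma Theta_fixes_one: "h \<in> carrier H \<Longrightarrow> Theta G H \<Phi> B h \<one>\<^bsub>G\<^esub> = \<one>\<^bsub>G\<^esub>"
  by (simp add: Theta_eq_act one_act)

lemma Theta_star:
  "h \<in> carrier H \<Longrightarrow> k \<in> carrier H \<Longrightarrow> g \<in> carrier G \<Longrightarrow>
    Theta G H \<Phi> B (h \<star> k) g = Theta G H \<Phi> B h (Theta G H \<Phi> B k g)"
  by (simp add: Theta_eq_act dagger_star act_star)

lemma Theta_one_H: "g \<in> carrier G \<Longrightarrow> Theta G H \<Phi> B \<one>\<^bsub>H\<^esub> g = g"
  by (simp add: Theta_eq_act dagger_one act_one)

lemma Theta_inverse:
  assumes "h \<in> carrier H" "g \<in> carrier G"
  shows "Theta G H \<Phi> B h (Theta G H \<Phi> B (h\<^sup>\<dagger>) g) = g"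
    and "Theta G H \<Phi> B (h\<^sup>\<dagger>) (Theta G H \<Phi> B h g) = g"
  using assms Theta_star[of h "h\<^sup>\<dagger>" g] Theta_star[of "h\<^sup>\<dagger>" h g]
  by (simp_all add: star_dagger dagger_star_self Theta_one_H)


section \<open>Smoothness of the action\<close>

lemma le_G: "locally_euclidean (mfd G)" and le_H: "locally_euclidean (mfd H)"
  by (rule smooth_manifold_imp_locally_euclidean, rule G.smooth_manifold H.smooth_manifold)+

lemma smooth_map_mult_G:
  assumes M: "locally_euclidean M" and f: "smooth_map M (mfd G) f" and g: "smooth_map M (mfd G) g"
  shows "smooth_map M (mfd G) (\<lambda>x. f x \<cdot> g x)"
  using smooth_map_compose[OF M locally_euclidean_prod[OF le_G le_G] le_G
      smooth_map_Pair[OF M le_G le_G f g] G.smooth_mult] by simp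

lemma smooth_map_action:
  assumes M: "locally_euclidean M" and f: "smooth_map M (mfd G) f" and g: "smooth_map M (mfd H) g"
  shows "smooth_map M (mfd H) (\<lambda>x. \<Phi> (f x) (g x))"
proof -
  have "smooth_map (prod_manifold (mfd G) (mfd H)) (mfd H) (\<lambda>(g, h). \<Phi> g h)"
    using action unfolding lie_group_action_def by blast
  from smooth_map_compose[OF M locally_euclidean_prod[OF le_G le_H] le_H
      smooth_map_Pair[OF M le_G le_H f g] this]
  show ?thesis by simp
qed

lemma smooth_dagger: "smooth_map (mfd H) (mfd H) (\<lambda>h. h\<^sup>\<dagger>)"
  unfolding dagger_def
  by (rule smooth_map_action[OF le_H smooth_map_compose[OF le_H le_G le_G smooth_B G.smooth_inv] H.smooth_inv])

text \<open>Joint smoothness in \<open>(h, g)\<close> is what allows the derivative in \<open>g\<close> to depend smoothly on \<open>h\<close>.\<close>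

lemma smooth_Theta: "smooth_map (prod_manifold (mfd H) (mfd G)) (mfd G) (\<lambda>(h, g). Theta G H \<Phi> B h g)"
proof -
  let ?P = "prod_manifold (mfd H) (mfd G)"
  have P: "locally_euclidean ?P" by (rule locally_euclidean_prod[OF le_H le_G])
  have g: "smooth_map ?P (mfd G) snd" by (rule smooth_map_snd[OF le_H G.smooth_manifold])
  have k: "smooth_map ?P (mfd H) (\<lambda>z. (fst z)\<^sup>\<dagger>)"
    by (rule smooth_map_compose[OF P le_H le_H smooth_map_fst[OF H.smooth_manifold le_G] smooth_dagger])
  have "smooth_map ?P (mfd G) (\<lambda>z. inv\<^bsub>G\<^esub> (B (\<Phi> (snd z) ((fst z)\<^sup>\<dagger>))) \<cdot> snd z \<cdot> B ((fst z)\<^sup>\<dagger>))"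
    by (intro smooth_map_mult_G[OF P] g smooth_map_compose[OF P le_H le_G k smooth_B]
        smooth_map_compose[OF P le_G le_G smooth_map_compose[OF P le_H le_G
            smooth_map_action[OF P g k] smooth_B] G.smooth_inv])
  then show ?thesis by (simp add: Theta_def case_prod_unfold)
qed

lemma smooth_Theta_at:
  assumes h: "h \<in> carrier H"
  shows "smooth_map (mfd G) (mfd G) (Theta G H \<Phi> B h)"
proof -
  have "smooth_map (mfd G) (prod_manifold (mfd H) (mfd G)) (\<lambda>g. (h, g))"
    using h H.topspace_eq_carrier
    by (intro smooth_map_Pair le_G le_H smooth_map_const smooth_map_id G.smooth_manifold) simp
  from smooth_map_compose[OF le_G locally_euclidean_prod[OF le_H le_G] le_G this smooth_Theta]
  show ?thesis by simp
qed

lemma diffeomorphism_Theta: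
  assumes h: "h \<in> carrier H"
  shows "diffeomorphism (mfd G) (mfd G) (Theta G H \<Phi> B h)"
  unfolding diffeomorphism_def G.topspace_eq_carrier
  using smooth_Theta_at[OF h] smooth_Theta_at[OF dagger_closed[OF h]] Theta_inverse[OF h] by blast

abbreviation dTheta :: "'h \<Rightarrow> (('g, 'e) chart \<Rightarrow> 'e) \<Rightarrow> ('g, 'e) chart \<Rightarrow> 'e" where
  "dTheta h \<equiv> tangent_map (mfd G) (mfd G) (Theta G H \<Phi> B h) \<one>\<^bsub>G\<^esub>"

lemma one_in_G: "\<one>\<^bsub>G\<^esub> \<in> topspace (mtop (mfd G))"
  by (simp add: G.topspace_eq_carrier)

lemma dTheta_in_linear_autos:
  assumes h: "h \<in> carrier H"
  shows "dTheta h \<in> linear_autos (lie_algebra G)"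
  unfolding lie_algebra_def
  using h tangent_map_in_linear_autos[OF G.smooth_manifold one_in_G, of "Theta G H \<Phi> B h" "Theta G H \<Phi> B (h\<^sup>\<dagger>)"]
  by (simp add: smooth_Theta_at Theta_fixes_one Theta_inverse G.topspace_eq_carrier)

lemma dTheta_star:
  assumes h: "h \<in> carrier H" and k: "k \<in> carrier H"
  shows "dTheta (h \<star> k) = compose (lie_algebra G) (dTheta h) (dTheta k)"
  unfolding lie_algebra_def
  by (rule tangent_map_compose[OF G.smooth_manifold one_in_G])
    (use h k in \<open>simp_all add: smooth_Theta_at Theta_fixes_one Theta_star G.topspace_eq_carrier\<close>)

lemma smooth_dTheta: "smooth_map (mfd H) (mfd (GL TYPE('e) (lie_algebra G))) dTheta"
proof -
  let ?c = "base_chart (mfd G) \<one>\<^bsub>G\<^esub>"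
  note c = base_chart[OF le_G one_in_G]
  show ?thesis
    unfolding lie_algebra_def
  proof (rule smooth_map_into_GL[OF le_H locally_euclidean_finite_dim[OF le_G]
        linear_tangent_vector[OF G.smooth_manifold c] bij_betw_tangent_vector[OF G.smooth_manifold c]])
    fix h assume "h \<in> topspace (mtop (mfd H))"
    then have h: "h \<in> carrier H" by (simp add: H.topspace_eq_carrier)
    note smooth = smooth_Theta_at[OF h] and fix1 = Theta_fixes_one[OF h]
    show "dTheta h \<in> linear_autos (tangent_space (mfd G) \<one>\<^bsub>G\<^esub>)"
      using dTheta_in_linear_autos[OF h] by (simp add: lie_algebra_def)
    show "dTheta h (tangent_vector (mfd G) \<one>\<^bsub>G\<^esub> ?c v) =
        tangent_vector (mfd G) \<one>\<^bsub>G\<^esub> ?c (chart_derivative ?c ?c (Theta G H \<Phi> B h) \<one>\<^bsub>G\<^esub> v)" for v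
      using tangent_map_tangent_vector[OF G.smooth_manifold G.smooth_manifold smooth one_in_G, of ?c v] c
      by (simp add: fix1)
    show "linear (chart_derivative ?c ?c (Theta G H \<Phi> B h) \<one>\<^bsub>G\<^esub>)"
      by (rule chart_derivative_linear[OF le_G le_G smooth c]) (simp_all add: fix1 c)
  next
    fix U \<phi> v assume U: "(U, \<phi>) \<in> atlas (mfd H)"
    show "smooth_on (\<phi> ` U)
        (\<lambda>x. chart_derivative ?c ?c (Theta G H \<Phi> B (inv_into U \<phi> x)) \<one>\<^bsub>G\<^esub> v)"
      by (rule smooth_on_parameter_derivative[OF le_H le_G le_G smooth_Theta c c(1) _ U])
        (simp add: H.topspace_eq_carrier Theta_fixes_one c)
  qed
qed

end

theorem lemma3p9:
  fixes G :: "('g, 'e::real_normed_vector) lie_grp"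
    and H :: "('h, 'f::real_normed_vector) lie_grp"
    and \<Phi> :: "'g \<Rightarrow> 'h \<Rightarrow> 'h"
    and B :: "'h \<Rightarrow> 'g"
  assumes "lie_group G" and "lie_group H"
    and "lie_group_action G H \<Phi>"
    and "relative_rota_baxter G H \<Phi> B"
  shows "(\<forall>h\<in>carrier H.
            diffeomorphism (mfd G) (mfd G) (Theta G H \<Phi> B h) \<and> Theta G H \<Phi> B h \<one>\<^bsub>G\<^esub> = \<one>\<^bsub>G\<^esub>) \<and>
         lie_group_hom (descendent H \<Phi> B) (GL TYPE('e) (lie_algebra G))
           (\<lambda>h. tangent_map (mfd G) (mfd G) (Theta G H \<Phi> B h) \<one>\<^bsub>G\<^esub>)"
proof -
  interpret rota_baxter G H \<Phi> B
    by (intro rota_baxter.intro rota_baxter_axioms.intro assms)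
  have "dTheta \<in> hom (descendent H \<Phi> B) (GL TYPE('e) (lie_algebra G))"
    using dTheta_in_linear_autos dTheta_star by (simp add: hom_def descendent_def GL_def)
  moreover have "smooth_map (mfd (descendent H \<Phi> B)) (mfd (GL TYPE('e) (lie_algebra G))) dTheta"
    using smooth_dTheta by (simp add: descendent_def)
  ultimately show ?thesis
    using diffeomorphism_Theta Theta_fixes_one by (simp add: lie_group_hom_def)
qed

end
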